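(* Let $n\ge1$ and let $f$ satisfy (F1)-(F4). Let $u$ be an entire solution of $$\partial_t u-\Delta u=f(u),\qquad 0<u<1\quad\text{in }\mathbb{R}^n\times\mathbb{R},$$ satisfying (H1) $\sup_{x\in\mathbb{R}^n}u(x,t)=1$ for every $t\in\mathbb{R}$, and (H2) $u(x,t)\to0$ uniformly as $\mathrm{dist}\big((x,t),\{u\ge1-b_0\}\big)\to+\infty$. Let $b\in(0,1)$ be such that $\{u=b\}=\{t=h(x)\}$ with $h:\mathbb{R}^n\to\mathbb{R}$ globally Lipschitz, and for $\lambda>0$ put $h_\lambda(x):=\frac1\lambda h(\lambda x)$. Suppose that $\lambda_i\to+\infty$ and $h_{\lambda_i}\to h_\infty$ locally uniformly on $\mathbb{R}^n$. Then $h_\infty$ is a viscosity solution of $$|\nabla h_\infty|^2-\kappa_\ast^{-2}=0\quad\text{in }\mathbb{R}^n.$$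
   Context: Hypotheses on $f:[0,1]\to\mathbb{R}$: (F1) $f$ is Lipschitz on $[0,1]$, $f(0)=f(1)=0$, and $f\in C^{1,\alpha}([0,\gamma)\cup(1-\gamma,1])$ for some $\alpha,\gamma\in(0,1)$; (F2) $f'(1)<0$; (F3) $\int_0^1 f(u)\,du>0$; (F4) there is $\theta\in(0,1)$ with $f>0$ in $(\theta,1)$ and either $f<0$ in $(0,\theta)$ with $f'(0)<0$ (bistable), or $f\equiv0$ in $(0,\theta)$ (combustion). An entire solution is a smooth solution defined on all of $\mathbb{R}^n\times\mathbb{R}$. $\mathrm{dist}$ is Euclidean distance in $\mathbb{R}^n\times\mathbb{R}$. Under (F1)-(F4), $\kappa_\ast>0$ denotes the unique constant for which the one-dimensional problem $-g''+\kappa_\ast g'=f(g)$ on $\mathbb{R}$, $g(-\infty)=0$, $g(+\infty)=1$, has a solution $g$ (unique up to translation). The constant $b_0\in(0,1)$ is a fixed constant depending only on $n$ and $f$ such that every entire solution $w$ of $\partial_t w-\Delta w=f(w)$, $0<w<1$, with $\sup_{x}w(x,t)=1$ for all $t$ satisfies: (a) for each $\lambda\in[1-b_0,1)$, $\{w=\lambda\}$ is the graph $\{t=h_\lambda(x)\}$ of a globally Lipschitz function on $\mathbb{R}^n$; (b) $\partial_t w\ge c_0(1-w)$ and $|\nabla w|+|\partial_t w|\le C_0(1-w)$ in $\{w>1-b_0\}$, with constants $c_0,C_0>0$ depending only on $n$ and $f$. Viscosity solution means: whenever $\varphi\in C^1$, if $h_\infty-\varphi$ has a local maximum at $x_0$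 then $|\nabla\varphi(x_0)|\le\kappa_\ast^{-1}$, and if $h_\infty-\varphi$ has a local minimum at $x_0$ then $|\nabla\varphi(x_0)|\ge\kappa_\ast^{-1}$. *)

theory Defs
  imports "HOL-Analysis.Analysis"
begin

text \<open>
  The nonlinearity \<open>f : [0,1] \<rightarrow> \<real>\<close> is rendered as a total function on the reals. Every condition
  below depends only on its values on \<open>[0,1]\<close>, and its derivatives at points of \<open>[0,1]\<close> are taken
  within \<open>[0,1]\<close>, so that they are one-sided at the endpoints.
\<close>

definition F1 :: "(real \<Rightarrow> real) \<Rightarrow> bool" where
  "F1 f \<longleftrightarrow>
     (\<exists>L. L-lipschitz_on {0..1} f) \<and> f 0 = 0 \<and> f 1 = 0 \<and>
     (\<exists>\<alpha> \<gamma>. 0 < \<alpha> \<and> \<alpha> < 1 \<and> 0 < \<gamma> \<and> \<gamma> < 1 \<and>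
       (\<exists>f' C.
         (\<forall>x \<in> {0..<\<gamma>} \<union> {1-\<gamma><..1}. (f has_real_derivative f' x) (at x within {0..1})) \<and>
         (\<forall>x \<in> {0..<\<gamma>} \<union> {1-\<gamma><..1}. \<forall>y \<in> {0..<\<gamma>} \<union> {1-\<gamma><..1}.
            \<bar>f' x - f' y\<bar> \<le> C * \<bar>x - y\<bar> powr \<alpha>)))"

definition F2 :: "(real \<Rightarrow> real) \<Rightarrow> bool" where
  "F2 f \<longleftrightarrow> (\<exists>d<0. (f has_real_derivative d) (at 1 within {0..1}))"

definition F3 :: "(real \<Rightarrow> real) \<Rightarrow> bool" where
  "F3 f \<longleftrightarrow> integral {0..1} f > 0"

definition F4 :: "(real \<Rightarrow> real) \<Rightarrow> bool" where
  "F4 f \<longleftrightarrow>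
     (\<exists>\<theta>. 0 < \<theta> \<and> \<theta> < 1 \<and> (\<forall>s \<in> {\<theta><..<1}. f s > 0) \<and>
       ((\<forall>s \<in> {0<..<\<theta>}. f s < 0) \<and> (\<exists>d<0. (f has_real_derivative d) (at 0 within {0..1}))
        \<or> (\<forall>s \<in> {0<..<\<theta>}. f s = 0)))"

text \<open>
  The range condition on the profile only records that \<open>f (g x)\<close> has to make sense
  for \<open>f\<close> defined on \<open>[0,1]\<close>.
\<close>

definition front_profile :: "(real \<Rightarrow> real) \<Rightarrow> real \<Rightarrow> (real \<Rightarrow> real) \<Rightarrow> bool" where
  "front_profile f \<kappa> g \<longleftrightarrow>
     (\<forall>x. 0 \<le> g x \<and> g x \<le> 1) \<and>
     (\<exists>g' g''. (\<forall>x. (g has_real_derivative g' x) (at x)) \<and>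
               (\<forall>x. (g' has_real_derivative g'' x) (at x)) \<and>
               (\<forall>x. - g'' x + \<kappa> * g' x = f (g x))) \<and>
     (g \<longlongrightarrow> 0) at_bot \<and> (g \<longlongrightarrow> 1) at_top"

definition is_front_speed :: "(real \<Rightarrow> real) \<Rightarrow> real \<Rightarrow> bool" where
  "is_front_speed f \<kappa> \<longleftrightarrow> \<kappa> > 0 \<and> (\<forall>c. (\<exists>g. front_profile f c g) \<longleftrightarrow> c = \<kappa>)"

text \<open>Functions on space-time have the pair \<open>(x, t)\<close> as argument.\<close>

definition partial_t :: "((real^'n) \<times> real \<Rightarrow> real) \<Rightarrow> (real^'n) \<times> real \<Rightarrow> real" where
  "partial_t w p = deriv (\<lambda>s. w (fst p, s)) (snd p)"

definition partial_x :: "'n::finite \<Rightarrow> ((real^'n) \<times> real \<Rightarrow> real) \<Rightarrow> (real^'n) \<times> real \<Rightarrow> real" where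
  "partial_x i w p = deriv (\<lambda>s. w (fst p + s *\<^sub>R axis i 1, snd p)) 0"

definition grad_x :: "((real^'n::finite) \<times> real \<Rightarrow> real) \<Rightarrow> (real^'n) \<times> real \<Rightarrow> real^'n" where
  "grad_x w p = (\<chi> i. partial_x i w p)"

definition laplace_x :: "((real^'n::finite) \<times> real \<Rightarrow> real) \<Rightarrow> (real^'n) \<times> real \<Rightarrow> real" where
  "laplace_x w p = (\<Sum>i\<in>UNIV. partial_x i (partial_x i w) p)"

definition partially_differentiable_x :: "'n::finite \<Rightarrow> ((real^'n) \<times> real \<Rightarrow> real) \<Rightarrow> bool" where
  "partially_differentiable_x i w \<longleftrightarrow>
     (\<forall>x t. (\<lambda>s. w (x + s *\<^sub>R axis i 1, t)) differentiable (at 0))"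

text \<open>
  Since \<open>f\<close> is only Lipschitz, smoothness of a solution means that it is classical: once continuously
  differentiable in time and twice in space.
\<close>

definition C21 :: "((real^'n::finite) \<times> real \<Rightarrow> real) \<Rightarrow> bool" where
  "C21 w \<longleftrightarrow>
     continuous_on UNIV w \<and>
     (\<forall>x t. (\<lambda>s. w (x, s)) differentiable (at t)) \<and> continuous_on UNIV (partial_t w) \<and>
     (\<forall>i. partially_differentiable_x i w \<and> continuous_on UNIV (partial_x i w)) \<and>
     (\<forall>i j. partially_differentiable_x j (partial_x i w) \<and>
            continuous_on UNIV (partial_x j (partial_x i w)))"

definition entire_solution :: "(real \<Rightarrow> real) \<Rightarrow> ((real^'n::finite) \<times> real \<Rightarrow> real) \<Rightarrow> bool" where
  "entire_solution f w \<longleftrightarrow>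
     C21 w \<and> (\<forall>p. 0 < w p \<and> w p < 1) \<and> (\<forall>p. partial_t w p - laplace_x w p = f (w p))"

definition H1 :: "((real^'n::finite) \<times> real \<Rightarrow> real) \<Rightarrow> bool" where
  "H1 w \<longleftrightarrow> (\<forall>t. (SUP x. w (x, t)) = 1)"

text \<open>
  The metric of the product type \<open>real^'n \<times> real\<close> is the Euclidean one. The convention
  \<open>infdist p {} = 0\<close> is harmless here because \<open>H1\<close> makes the superlevel set nonempty.
\<close>

definition H2 :: "real \<Rightarrow> ((real^'n::finite) \<times> real \<Rightarrow> real) \<Rightarrow> bool" where
  "H2 b0 w \<longleftrightarrow>
     (\<forall>\<epsilon>>0. \<exists>R. \<forall>p. infdist p {q. w q \<ge> 1 - b0} \<ge> R \<longrightarrow> \<bar>w p\<bar> < \<epsilon>)"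

definition lipschitz_level_graph ::
    "((real^'n::finite) \<times> real \<Rightarrow> real) \<Rightarrow> real \<Rightarrow> (real^'n \<Rightarrow> real) \<Rightarrow> bool" where
  "lipschitz_level_graph w b h \<longleftrightarrow>
     (\<exists>L. L-lipschitz_on UNIV h) \<and> {p. w p = b} = {(x, t). t = h x}"

text \<open>
  The properties that specify \<open>b\<^sub>0\<close>. The dimension enters through the type argument; the
  constants \<open>c\<^sub>0\<close> and \<open>C\<^sub>0\<close> are uniform in the solution \<open>w\<close>.
\<close>

definition is_b0 :: "'n::finite itself \<Rightarrow> (real \<Rightarrow> real) \<Rightarrow> real \<Rightarrow> bool" where
  "is_b0 (_ :: 'n itself) f b0 \<longleftrightarrow>
     0 < b0 \<and> b0 < 1 \<and>
     (\<exists>c0>0. \<exists>C0>0. \<forall>w :: (real^'n) \<times> real \<Rightarrow> real. entire_solution f w \<and> H1 w \<longrightarrow>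
        (\<forall>\<mu>. 1 - b0 \<le> \<mu> \<and> \<mu> < 1 \<longrightarrow> (\<exists>h. lipschitz_level_graph w \<mu> h)) \<and>
        (\<forall>p. w p > 1 - b0 \<longrightarrow>
           partial_t w p \<ge> c0 * (1 - w p) \<and>
           norm (grad_x w p) + \<bar>partial_t w p\<bar> \<le> C0 * (1 - w p)))"

definition rescale :: "real \<Rightarrow> (real^'n::finite \<Rightarrow> real) \<Rightarrow> real^'n \<Rightarrow> real" where
  "rescale \<mu> h x = 1 / \<mu> * h (\<mu> *\<^sub>R x)"

text \<open>
  Viscosity solutions of \<open>|\<nabla>v|\<^sup>2 - \<kappa>\<^sup>-\<^sup>2 = 0\<close> on the whole space; \<open>D\<close> is the gradient of the
  continuously differentiable test function \<open>\<phi>\<close>.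
\<close>

definition eikonal_viscosity_solution :: "real \<Rightarrow> (real^'n::finite \<Rightarrow> real) \<Rightarrow> bool" where
  "eikonal_viscosity_solution \<kappa> v \<longleftrightarrow>
     (\<forall>\<phi> D x0. (\<forall>x. GDERIV \<phi> x :> D x) \<and> continuous_on UNIV D \<longrightarrow>
        ((\<forall>\<^sub>F x in nhds x0. v x - \<phi> x \<le> v x0 - \<phi> x0) \<longrightarrow> norm (D x0) \<le> inverse \<kappa>) \<and>
        ((\<forall>\<^sub>F x in nhds x0. v x - \<phi> x \<ge> v x0 - \<phi> x0) \<longrightarrow> norm (D x0) \<ge> inverse \<kappa>))"

end

theory Submission
  imports Defs
begin

text \<open>
  The level set \<open>t = h x\<close> records the time at which the stable state \<open>1\<close> invades the point \<open>x\<close>. An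
  eikonal equation \<open>\<bar>\<nabla>h\<bar> = 1 / \<kappa>\<close> says that the invasion advances with speed \<open>\<kappa>\<close>, and each half of
  the viscosity property is a bound on this speed, tested on large balls.

  Both bounds come from comparing \<open>u\<close> with spherical fronts built on the one-dimensional profile \<open>g\<close>
  of speed \<open>\<kappa>\<close>. A contracting front of speed \<open>\<nu> > \<kappa>\<close>, raised by a small \<open>\<sigma>\<close>, is a supersolution, and
  an expanding front of speed \<open>\<nu> < \<kappa>\<close>, lowered by \<open>\<sigma>\<close>, is a subsolution: the difference of the speeds
  leaves a multiple of \<open>g'\<close> to spare in the transition zone, and the shift by \<open>\<sigma>\<close> exploits the decrease
  of \<open>f\<close> near \<open>0\<close> and \<open>1\<close>. The curvature of the spheres is harmless because their radii are large, and
  at the centre the norm is smoothed. This yields two propagation estimates with errors that do not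
  grow with the scale: \<open>invasion_not_faster_than_front\<close> and \<open>invasion_not_slower_than_front\<close>. They
  rest on the comparison \<open>spherical_barrier_comparison\<close> and, for the spare multiple of \<open>g'\<close>, on the
  strict monotonicity of the profile, \<open>front_profile_monotone\<close>, which an energy argument gives.

  To apply the estimates, \<open>u\<close> has to be close to \<open>1\<close> at bounded distance above the graph of \<open>h\<close> and
  close to \<open>0\<close> at bounded distance below it. This is \<open>transition_layer_width\<close>, which combines the
  growth condition beyond the level \<open>1 - b\<^sub>0\<close> with the uniform decay far from it.

  Finally, suppose that a test function touches \<open>h_inf\<close> at \<open>x0\<close> with a gradient of the wrong size. Then
  \<open>h_inf\<close> lies on one side of a plane up to a small linear error, so at a large scale \<open>\<lambda>\<close> the graph of
  \<open>h\<close> reaches \<open>\<lambda> x0\<close> too early or too late by an amount proportional to \<open>\<lambda>\<close>. Since all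
  constants in the propagation estimates are bounded, this contradicts \<open>u = b\<close> on the graph.
\<close>

section \<open>The parabolic maximum principle\<close>

lemma second_derivative_nonpos_at_local_max:
  fixes \<psi> :: "real \<Rightarrow> real"
  assumes d1: "\<And>s. (\<psi> has_real_derivative d s) (at s)"
    and d2: "(d has_real_derivative e) (at a)"
    and \<delta>: "0 < \<delta>" and max: "\<And>s. \<bar>s - a\<bar> < \<delta> \<Longrightarrow> \<psi> s \<le> \<psi> a"
  shows "e \<le> 0"
proof (rule ccontr)
  assume "\<not> e \<le> 0"
  then have "0 < e" by simp
  have "d a = 0"
    using DERIV_local_max[OF d1[of a] \<delta>] max by (simp add: abs_minus_commute)
  obtain r where r: "0 < r" "\<And>h. 0 < h \<Longrightarrow> h < r \<Longrightarrow> d a < d (a + h)"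
    using DERIV_pos_inc_right[OF d2 \<open>0 < e\<close>] by blast
  define k where "k = min r \<delta> / 2"
  have k: "0 < k" "k < r" "k < \<delta>"
    using r(1) \<delta> by (auto simp: k_def)
  have "\<psi> a < \<psi> (a + k)"
  proof (rule DERIV_pos_imp_increasing_open[where f = \<psi>])
    fix x assume "a < x" "x < a + k"
    then have "0 < d x"
      using r(2)[of "x - a"] k \<open>d a = 0\<close> by simp
    then show "\<exists>y. (\<psi> has_real_derivative y) (at x) \<and> 0 < y"
      using d1 by blast
  next
    show "continuous_on {a..a + k} \<psi>"
      using d1 DERIV_isCont by (blast intro: continuous_at_imp_continuous_on)
  qed (use k in simp)
  with max[of "a + k"] k show False by simp
qed

text \<open>
  A maximum principle for functions that are only required to be subsolutions of
  \<open>v\<^sub>t = \<Delta>v + L v\<close> where they are positive. This is the form that a comparison of \<open>u\<close> with a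
  barrier needs, because a barrier satisfies its differential inequality only where it takes values
  in \<open>(0,1)\<close>. With \<open>K > L\<close>, a positive maximum of \<open>exp (- K t) v\<close> would give
  \<open>K v \<le> v\<^sub>t \<le> \<Delta>v + L v \<le> L v\<close> there. The top \<open>t = T1\<close> of the cylinder is not part of the
  boundary: only the time derivative from the left enters.
\<close>

theorem parabolic_maximum_principle:
  fixes v :: "(real^'n::finite) \<times> real \<Rightarrow> real"
  assumes cont: "continuous_on (cball y R \<times> {T0..T1}) v"
    and initial: "\<And>x. x \<in> cball y R \<Longrightarrow> v (x, T0) \<le> 0"
    and lateral: "\<And>x t. dist y x = R \<Longrightarrow> T0 \<le> t \<Longrightarrow> t \<le> T1 \<Longrightarrow> v (x, t) \<le> 0"
    and subsol: "\<And>x t. 0 < v (x, t) \<Longrightarrow> dist y x < R \<Longrightarrow> T0 < t \<Longrightarrow> t \<le> T1 \<Longrightarrow>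
      \<exists>a d e. ((\<lambda>\<tau>. v (x, \<tau>)) has_real_derivative a) (at t) \<and>
        (\<forall>i s. ((\<lambda>s. v (x + s *\<^sub>R axis i 1, t)) has_real_derivative d i s) (at s)) \<and>
        (\<forall>i. (d i has_real_derivative e i) (at 0)) \<and>
        a \<le> (\<Sum>i\<in>UNIV. e i) + L * v (x, t)"
    and x: "x \<in> cball y R" and t: "T0 \<le> t" "t \<le> T1"
  shows "v (x, t) \<le> 0"
proof (rule ccontr)
  assume "\<not> v (x, t) \<le> 0"
  define K where "K = \<bar>L\<bar> + 1"
  define V where "V p = exp (- K * snd p) * v p" for p
  let ?Q = "cball y R \<times> {T0..T1}"
  have "continuous_on ?Q V"
    unfolding V_def using cont by (intro continuous_intros)
  moreover have "compact ?Q" by (intro compact_Times) auto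
  moreover have xt: "(x, t) \<in> ?Q" using x t by simp
  ultimately obtain p where p: "p \<in> ?Q" "\<And>q. q \<in> ?Q \<Longrightarrow> V q \<le> V p"
    using continuous_attains_sup[of ?Q V] by blast
  obtain z r where zr: "p = (z, r)" by (cases p)
  have "0 < V (x, t)" using \<open>\<not> v (x, t) \<le> 0\<close> by (simp add: V_def)
  with p(2)[OF xt] have "0 < V p" by simp
  then have vpos: "0 < v (z, r)" by (simp add: V_def zr zero_less_mult_iff)
  have "T0 \<noteq> r" using initial[of z] vpos p(1) zr by auto
  then have r: "T0 < r" "r \<le> T1" using p(1) zr by auto
  have "dist y z \<noteq> R" using lateral[of z r] r vpos by auto
  then have z: "dist y z < R" using p(1) zr by auto
  from subsol[OF vpos z r] obtain a d e where
    a: "((\<lambda>\<tau>. v (z, \<tau>)) has_real_derivative a) (at r)" and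
    d: "\<And>i s. ((\<lambda>s. v (z + s *\<^sub>R axis i 1, r)) has_real_derivative d i s) (at s)" and
    e: "\<And>i. (d i has_real_derivative e i) (at 0)" and
    le: "a \<le> (\<Sum>i\<in>UNIV. e i) + L * v (z, r)"
    by blast
  \<comment> \<open>The maximum over the cylinder is in particular a local one along each coordinate axis.\<close>
  have "e i \<le> 0" for i
  proof (rule second_derivative_nonpos_at_local_max[OF d e])
    show "0 < R - dist y z" using z by simp
    fix s :: real assume "\<bar>s - 0\<bar> < R - dist y z"
    moreover have "dist y (z + s *\<^sub>R axis i 1) \<le> dist y z + \<bar>s\<bar>"
      using dist_triangle[of y "z + s *\<^sub>R axis i 1" z] by (simp add: dist_norm norm_axis_1)
    ultimately have "(z + s *\<^sub>R axis i 1, r) \<in> ?Q" using r by auto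
    from p(2)[OF this]
    show "v (z + s *\<^sub>R axis i 1, r) \<le> v (z + 0 *\<^sub>R axis i 1, r)" by (simp add: V_def zr)
  qed
  then have "(\<Sum>i\<in>UNIV. e i) \<le> 0" by (simp add: sum_nonpos)
  have dV: "((\<lambda>\<tau>. exp (- K * \<tau>) * v (z, \<tau>)) has_real_derivative
      exp (- K * r) * (a - K * v (z, r))) (at r)"
    by (rule derivative_eq_intros a refl)+ (simp add: algebra_simps)
  have "0 \<le> exp (- K * r) * (a - K * v (z, r))"
  proof (rule ccontr)
    assume "\<not> 0 \<le> exp (- K * r) * (a - K * v (z, r))"
    then obtain \<delta> where \<delta>: "0 < \<delta>"
      "\<And>k. 0 < k \<Longrightarrow> k < \<delta> \<Longrightarrow> V (z, r) < V (z, r - k)"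
      using DERIV_neg_dec_left[OF dV] by (auto simp: V_def)
    define k where "k = min \<delta> (r - T0) / 2"
    have k: "0 < k" "k < \<delta>" "k < r - T0" using \<delta> r by (auto simp: k_def)
    have "(z, r - k) \<in> ?Q" using k r z by auto
    from p(2)[OF this] \<delta>(2)[of k] k show False by (simp add: zr)
  qed
  then have "K * v (z, r) \<le> a" by (simp add: zero_le_mult_iff)
  with le \<open>(\<Sum>i\<in>UNIV. e i) \<le> 0\<close> have "K * v (z, r) \<le> L * v (z, r)" by simp
  with vpos have "K \<le> L" by simp
  then show False by (simp add: K_def)
qed

section \<open>Monotonicity of the travelling front\<close>

text \<open>
  The ordinary differential equation of the front is recorded through its second derivative
  \<open>g'' = \<kappa> g' - f g\<close>, which is how the barriers use it.
\<close>

definition monotone_front :: "(real \<Rightarrow> real) \<Rightarrow> real \<Rightarrow> (real \<Rightarrow> real) \<Rightarrow> (real \<Rightarrow> real) \<Rightarrow> bool" where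
  "monotone_front f \<kappa> g g' \<longleftrightarrow>
     (\<forall>z. 0 \<le> g z \<and> g z \<le> 1) \<and>
     (\<forall>z. (g has_real_derivative g' z) (at z)) \<and>
     (\<forall>z. (g' has_real_derivative \<kappa> * g' z - f (g z)) (at z)) \<and>
     (g \<longlongrightarrow> 0) at_bot \<and> (g \<longlongrightarrow> 1) at_top \<and> (g' \<longlongrightarrow> 0) at_top \<and>
     (\<forall>z. 0 \<le> g' z) \<and> (\<forall>z. 0 < g z \<and> g z < 1 \<longrightarrow> 0 < g' z)"

text \<open>
  Convergence of \<open>g\<close> alone does not make \<open>g'\<close> converge; by the mean value theorem \<open>g'\<close> is small at
  least somewhere beyond every point. This suffices to bound a monotone energy from above.
\<close>

lemma slope_attains_small_values_at_infinity:
  fixes g :: "real \<Rightarrow> real"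
  assumes d: "\<And>z. (g has_real_derivative g' z) (at z)" and lim: "(g \<longlongrightarrow> l) at_top"
    and "0 < \<epsilon>"
  shows "\<exists>z \<ge> Z. \<bar>g' z\<bar> < \<epsilon>"
proof -
  have "\<forall>\<^sub>F z in at_top. dist (g z) l < \<epsilon> / 2"
    using lim \<open>0 < \<epsilon>\<close> by (intro tendstoD) auto
  then obtain Y where Y: "\<And>z. Y \<le> z \<Longrightarrow> dist (g z) l < \<epsilon> / 2"
    by (auto simp: eventually_at_top_linorder)
  define a where "a = max Y Z"
  obtain z where z: "a < z" "z < a + 1" "g (a + 1) - g a = (a + 1 - a) * g' z"
    using MVT2[of a "a + 1" g g'] d by auto
  have "dist (g (a + 1)) (g a) < \<epsilon>"
    using dist_triangle_half_l[of "g (a + 1)" l \<epsilon> "g a"] Y by (simp add: a_def dist_commute)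
  then have "\<bar>g' z\<bar> < \<epsilon>" using z(3) by (simp add: dist_real_def)
  moreover have "Z \<le> z" using z(1) by (simp add: a_def)
  ultimately show ?thesis by blast
qed

text \<open>
  The energy \<open>E = g'\<^sup>2 / 2 + F g\<close>, with \<open>F\<close> the primitive of \<open>f\<close> vanishing at \<open>0\<close>, satisfies
  \<open>E' = \<kappa> g'\<^sup>2 \<ge> 0\<close>, so it increases from \<open>F 0 = 0\<close> to \<open>F 1 > 0\<close>. At a critical point \<open>E\<close> equals
  \<open>F g\<close>, and \<open>F \<le> 0\<close> on \<open>[0,\<theta>]\<close>; hence a critical value in \<open>(0,1)\<close> lies above \<open>\<theta>\<close>, where \<open>f > 0\<close>
  makes the critical point a strict local maximum. The front must then turn back towards \<open>1\<close>, and
  it does so at a minimum, where \<open>f \<le> 0\<close> and therefore \<open>F \<le> 0\<close>: this contradicts \<open>E > 0\<close>.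
  Without critical values in \<open>(0,1)\<close>, a descent of \<open>g\<close> could only start from the value \<open>1\<close>; but
  there the energy has already reached its limit \<open>F 1\<close>, and \<open>g\<close> is constant from then on.
\<close>

theorem front_profile_monotone:
  assumes f: "continuous_on {0..1} f" and F3: "F3 f" and F4: "F4 f"
    and \<kappa>: "0 < \<kappa>" and front: "front_profile f \<kappa> g"
  obtains g' where "monotone_front f \<kappa> g g'"
proof -
  from front obtain g' g'' where
    range: "\<And>z. 0 \<le> g z" "\<And>z. g z \<le> 1" and
    dg: "\<And>z. (g has_real_derivative g' z) (at z)" and
    dg': "\<And>z. (g' has_real_derivative g'' z) (at z)" and
    ode: "\<And>z. - g'' z + \<kappa> * g' z = f (g z)" and
    bot: "(g \<longlongrightarrow> 0) at_bot" and top: "(g \<longlongrightarrow> 1) at_top"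
    unfolding front_profile_def by blast
  have contg: "continuous_on A g" for A
    using dg DERIV_isCont by (blast intro: continuous_at_imp_continuous_on)
  from F4 obtain \<theta> where \<theta>: "0 < \<theta>" "\<theta> < 1" "\<And>s. \<theta> < s \<Longrightarrow> s < 1 \<Longrightarrow> 0 < f s"
    and neg: "\<And>s. 0 < s \<Longrightarrow> s < \<theta> \<Longrightarrow> f s \<le> 0"
    unfolding F4_def by (force simp: less_imp_le)

  obtain F0 where "\<And>x. x \<in> {0..1} \<Longrightarrow> (F0 has_vector_derivative f x) (at x within {0..1})"
    using antiderivative_continuous[OF f] by blast
  then have F0: "\<And>x. x \<in> {0..1} \<Longrightarrow> (F0 has_real_derivative f x) (at x within {0..1})"
    by (simp add: has_real_derivative_iff_has_vector_derivative)
  define F where "F x = F0 x - F0 0" for x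
  have dF: "(F has_real_derivative f x) (at x within {0..1})" if "x \<in> {0..1}" for x
    unfolding F_def using F0[OF that] by (auto intro!: derivative_eq_intros)
  have contF: "continuous_on {0..1} F"
    using dF DERIV_isCont by (meson DERIV_continuous continuous_on_eq_continuous_within)
  have F_0: "F 0 = 0" by (simp add: F_def)
  have "(f has_integral F 1 - F 0) {0..1}"
    using dF by (intro fundamental_theorem_of_calculus)
      (auto simp: has_real_derivative_iff_has_vector_derivative)
  then have F_1: "0 < F 1"
    using F3 F_0 by (simp add: F3_def integral_unique)
  have F_nonpos: "F v \<le> 0" if "0 \<le> v" "v \<le> \<theta>" for v
  proof -
    have "F v \<le> F 0"
    proof (rule DERIV_nonpos_imp_decreasing_open[OF that(1)])
      fix x assume x: "0 < x" "x < v"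
      then have "(F has_real_derivative f x) (at x)"
        using dF[of x] that \<theta> at_within_interior[of x "{0..1}"] by auto
      then show "\<exists>y. (F has_real_derivative y) (at x) \<and> y \<le> 0"
        using neg[of x] x that by auto
    next
      show "continuous_on {0..v} F"
        using contF that \<theta> by (auto intro: continuous_on_subset)
    qed
    then show ?thesis by (simp add: F_0)
  qed

  define E where "E z = (g' z)\<^sup>2 / 2 + F (g z)" for z
  have dE: "(E has_real_derivative \<kappa> * (g' z)\<^sup>2) (at z)" for z
  proof -
    have "(F has_real_derivative f (g z)) (at (g z) within range g)"
      using dF[of "g z"] range by (auto intro: has_field_derivative_subset)
    from DERIV_image_chain[OF this dg]
    have "((\<lambda>z. F (g z)) has_real_derivative f (g z) * g' z) (at z)"
      by (simp add: o_def)
    then have "(E has_real_derivative g' z * g'' z + f (g z) * g' z) (at z)"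
      unfolding E_def by (auto intro!: derivative_eq_intros dg')
    moreover have "g' z * g'' z + f (g z) * g' z = \<kappa> * (g' z)\<^sup>2"
      unfolding ode[of z, symmetric] by (simp add: algebra_simps power2_eq_square)
    ultimately show ?thesis by simp
  qed
  have E_mono: "E a \<le> E c" if "a \<le> c" for a c
    using DERIV_nonneg_imp_nondecreasing[OF that, of E] dE \<kappa> by (metis mult_nonneg_nonneg less_imp_le zero_le_power2)
  have E_const: "g' z = 0" if "a < z" "z < c" "E c \<le> E a" for a z c
  proof -
    have "E x = E z" if "\<bar>x - z\<bar> < min (z - a) (c - z)" for x
      using that E_mono[of a x] E_mono[of x c] E_mono[of a z] E_mono[of z c] \<open>E c \<le> E a\<close> \<open>a < z\<close> \<open>z < c\<close>
      by linarith
    then have "\<forall>x. \<bar>z - x\<bar> < min (z - a) (c - z) \<longrightarrow> E z = E x"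
      by (metis abs_minus_commute)
    moreover have "0 < min (z - a) (c - z)" using that by simp
    ultimately have "\<kappa> * (g' z)\<^sup>2 = 0"
      by (rule DERIV_local_const[OF dE, rotated])
    then show ?thesis using \<kappa> by simp
  qed
  have F_tendsto: "((\<lambda>z. F (g z)) \<longlongrightarrow> F l) G" if "(g \<longlongrightarrow> l) G" "l \<in> {0..1}" for l G
    by (rule continuous_on_tendsto_compose[OF contF that]) (use range in auto)
  have E_nonneg: "0 \<le> E z" for z
  proof (rule tendsto_upperbound)
    show "((\<lambda>w. F (g w)) \<longlongrightarrow> 0) at_bot"
      using F_tendsto[OF bot] F_0 by simp
    show "\<forall>\<^sub>F w in at_bot. F (g w) \<le> E z"
      using eventually_le_at_bot[of z]
    proof eventually_elim
      case (elim w)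
      then show ?case using E_mono[of w z] by (simp add: E_def add_increasing order_trans[rotated])
    qed
  qed simp
  have E_le: "E z \<le> F 1" for z
  proof (rule field_le_epsilon)
    fix \<epsilon> :: real assume "0 < \<epsilon>"
    have "\<forall>\<^sub>F w in at_top. F (g w) < F 1 + \<epsilon> / 2"
      using F_tendsto[OF top] \<open>0 < \<epsilon>\<close> by (intro order_tendstoD) auto
    then obtain Y where Y: "\<And>w. Y \<le> w \<Longrightarrow> F (g w) < F 1 + \<epsilon> / 2"
      by (auto simp: eventually_at_top_linorder)
    obtain w where w: "max Y z \<le> w" "\<bar>g' w\<bar> < sqrt \<epsilon>"
      using slope_attains_small_values_at_infinity[OF dg top, of "sqrt \<epsilon>" "max Y z"] \<open>0 < \<epsilon>\<close>
      by auto
    have "(g' w)\<^sup>2 \<le> \<epsilon>"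
      using w(2) \<open>0 < \<epsilon>\<close> by (metis abs_le_square_iff abs_of_nonneg less_imp_le power2_abs real_sqrt_ge_zero real_sqrt_pow2)
    then show "E z \<le> F 1 + \<epsilon>"
      using E_mono[of z w] Y[of w] w by (simp add: E_def)
  qed
  \<comment> \<open>If the energy vanished at \<open>z\<close>, it would vanish on the whole half-line before \<open>z\<close>, and \<open>g\<close> would be
    constant there although it tends to \<open>0\<close>.\<close>
  have E_pos: "0 < E z" if "0 < g z" for z
  proof (rule ccontr)
    assume "\<not> 0 < E z"
    then have "g' x = 0" if "x < z" for x
      using E_const[of "x - 1" x z] E_nonneg[of "x - 1"] that by simp
    then have const: "g x = g z" if "x < z" for x
      using DERIV_isconst_end[OF that contg, of ] dg by metis
    have "\<forall>\<^sub>F x in at_bot. g x < g z"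
      using bot that by (intro order_tendstoD) auto
    then obtain x where "x < z" "g x < g z"
      using eventually_conj[OF _ eventually_gt_at_bot] 
      by (metis (mono_tags, lifting) eventually_at_bot_dense eventually_gt_at_bot lt_ex min_less_iff_conj)
    with const show False by simp
  qed

  have slope_nonzero: "g' z \<noteq> 0" if z: "0 < g z" "g z < 1" for z
  proof
    assume "g' z = 0"
    then have "0 < F (g z)" using E_pos[OF z(1)] by (simp add: E_def)
    then have "\<theta> < g z" using F_nonpos[of "g z"] z by linarith
    then have "g'' z < 0" using \<theta>(3)[of "g z"] z ode[of z] \<open>g' z = 0\<close> by simp
    then obtain r where r: "0 < r" "\<And>k. 0 < k \<Longrightarrow> k < r \<Longrightarrow> g' (z + k) < 0"
      using DERIV_neg_dec_right[OF dg'] \<open>g' z = 0\<close> by metis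
    define y where "y = z + r / 2"
    have "z < y" "g y < g z"
    proof -
      show "z < y" using r by (simp add: y_def)
      then show "g y < g z"
      proof (rule DERIV_neg_imp_decreasing_open[where f = g])
        fix x assume "z < x" "x < y"
        then show "\<exists>D. (g has_real_derivative D) (at x) \<and> D < 0"
          using r(2)[of "x - z"] r(1) dg[of x] by (auto simp: y_def)
      qed (rule contg)
    qed
    have "\<forall>\<^sub>F x in at_top. g z < g x"
      using top z by (intro order_tendstoD) auto
    then obtain Y where Y: "\<And>x. Y \<le> x \<Longrightarrow> g z < g x"
      by (auto simp: eventually_at_top_linorder)
    have "y < Y" using Y[of y] \<open>g y < g z\<close> by (meson linorder_not_less order.asym)
    obtain m where m: "m \<in> {z..Y}" "\<And>x. x \<in> {z..Y} \<Longrightarrow> g m \<le> g x"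
      using continuous_attains_inf[of "{z..Y}" g] contg \<open>z < y\<close> \<open>y < Y\<close> by auto
    have "g m < g z" using m(2)[of y] \<open>z < y\<close> \<open>y < Y\<close> \<open>g y < g z\<close> by simp
    then have "z < m" "m < Y"
      using m(1) Y[of Y] by (auto simp: less_le)
    have min: "g m \<le> g x" if "\<bar>x - m\<bar> < min (m - z) (Y - m)" for x
      using m(2)[of x] that by (simp add: abs_less_iff)
    have "g' m = 0"
      using DERIV_local_min[OF dg[of m], of "min (m - z) (Y - m)"] min \<open>z < m\<close> \<open>m < Y\<close>
      by (auto simp: abs_minus_commute)
    have "- g'' m \<le> 0"
    proof (rule second_derivative_nonpos_at_local_max[of "\<lambda>x. - g x" "\<lambda>x. - g' x"])
      show "0 < min (m - z) (Y - m)" using \<open>z < m\<close> \<open>m < Y\<close> by simp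
    qed (use dg dg' min in \<open>auto intro!: derivative_eq_intros\<close>)
    then have "f (g m) \<le> 0" using ode[of m] \<open>g' m = 0\<close> by simp
    then have "g m \<le> \<theta>" using \<theta>(3)[of "g m"] \<open>g m < g z\<close> z by linarith
    then have "E m \<le> 0" using F_nonpos[of "g m"] range \<open>g' m = 0\<close> by (simp add: E_def)
    then show False using E_mono[of z m] \<open>z < m\<close> E_pos[OF z(1)] by simp
  qed

  have slope_nonneg: "0 \<le> g' z" for z
  proof (rule ccontr)
    assume "\<not> 0 \<le> g' z"
    then have "g' z < 0" by simp
    obtain r where r: "0 < r" "\<And>k. 0 < k \<Longrightarrow> k < r \<Longrightarrow> g z < g (z - k)"
      using DERIV_neg_dec_left[OF dg \<open>g' z < 0\<close>] by metis
    define y where "y = z - r / 2"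
    have y: "y < z" "g z < g y" using r by (auto simp: y_def)
    then have "0 < g y" using range(1)[of z] by linarith
    then have "\<forall>\<^sub>F x in at_bot. g x < g y"
      using bot by (intro order_tendstoD) auto
    then obtain Y where Y: "\<And>x. x \<le> Y \<Longrightarrow> g x < g y"
      by (auto simp: eventually_at_bot_linorder)
    have "Y < y" using Y[of y] by (meson linorder_not_less order.irrefl)
    obtain m where m: "m \<in> {Y..z}" "\<And>x. x \<in> {Y..z} \<Longrightarrow> g x \<le> g m"
      using continuous_attains_sup[of "{Y..z}" g] contg \<open>Y < y\<close> y by auto
    have "g y \<le> g m" using m(2)[of y] \<open>Y < y\<close> y by simp
    then have "Y < m" "m < z"
      using m(1) Y[of Y] y by (auto simp: less_le)
    have "g x \<le> g m" if "\<bar>m - x\<bar> < min (m - Y) (z - m)" for x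
      using m(2)[of x] that by (simp add: abs_less_iff)
    then have "g' m = 0"
      using DERIV_local_max[OF dg[of m], of "min (m - Y) (z - m)"] \<open>Y < m\<close> \<open>m < z\<close> by simp
    then have "g m = 1"
      using slope_nonzero[of m] range[of m] \<open>g y \<le> g m\<close> \<open>0 < g y\<close> by linarith
    then have "F 1 \<le> E m" by (simp add: E_def)
    then have "g' z = 0"
      using E_const[of m z "z + 1"] E_le[of "z + 1"] \<open>m < z\<close> by simp
    then show False using \<open>g' z < 0\<close> by simp
  qed

  \<comment> \<open>The bound \<open>E \<le> F 1\<close> also controls the slope: \<open>g'\<^sup>2 \<le> 2 (F 1 - F g)\<close>.\<close>
  have "((\<lambda>z. sqrt (2 * (F 1 - F (g z)))) \<longlongrightarrow> sqrt (2 * (F 1 - F 1))) at_top"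
    using F_tendsto[OF top] by (intro tendsto_intros) auto
  then have lim: "((\<lambda>z. sqrt (2 * (F 1 - F (g z)))) \<longlongrightarrow> 0) at_top" by simp
  have "(g' \<longlongrightarrow> 0) at_top"
  proof (rule tendsto_sandwich[OF _ _ tendsto_const lim])
    show "\<forall>\<^sub>F z in at_top. 0 \<le> g' z" using slope_nonneg by simp
    have "g' z \<le> sqrt (2 * (F 1 - F (g z)))" for z
      using E_le[of z] by (intro real_le_rsqrt) (simp add: E_def)
    then show "\<forall>\<^sub>F z in at_top. g' z \<le> sqrt (2 * (F 1 - F (g z)))" by simp
  qed
  moreover have "0 < g' z" if "0 < g z" "g z < 1" for z
    using slope_nonzero[OF that] slope_nonneg[of z] by simp
  moreover have "g'' z = \<kappa> * g' z - f (g z)" for z using ode[of z] by simp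
  ultimately have "monotone_front f \<kappa> g g'"
    unfolding monotone_front_def using range dg dg' bot top slope_nonneg by metis
  then show ?thesis by (rule that)
qed

lemma monotone_frontD:
  assumes "monotone_front f \<kappa> g g'"
  shows "0 \<le> g z" "g z \<le> 1" "(g has_real_derivative g' z) (at z)"
    "(g' has_real_derivative \<kappa> * g' z - f (g z)) (at z)" "0 \<le> g' z"
    "(g \<longlongrightarrow> 0) at_bot" "(g \<longlongrightarrow> 1) at_top" "(g' \<longlongrightarrow> 0) at_top"
  using assms by (auto simp: monotone_front_def)

lemma monotone_front_mono:
  assumes "monotone_front f \<kappa> g g'" "y \<le> z"
  shows "g y \<le> g z"
  using DERIV_nonneg_imp_nondecreasing[OF assms(2), of g] monotone_frontD(3,5)[OF assms(1)] by blast

text \<open>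
  The front takes values between two levels inside \<open>(0,1)\<close> only on a bounded set, so its positive slope
  attains a minimum there. This is the reserve that pays for all errors in the transition zone
  of the barriers.
\<close>

lemma monotone_front_slope_bound:
  assumes front: "monotone_front f \<kappa> g g'" and "0 < \<alpha>" "\<beta> < 1"
  obtains m where "0 < m" "\<And>z. \<alpha> \<le> g z \<Longrightarrow> g z \<le> \<beta> \<Longrightarrow> m \<le> g' z"
proof -
  note D = monotone_frontD[OF front]
  have "\<forall>\<^sub>F z in at_bot. g z < \<alpha>"
    using D(6) \<open>0 < \<alpha>\<close> by (intro order_tendstoD) auto
  then obtain Y where Y: "\<And>z. z \<le> Y \<Longrightarrow> g z < \<alpha>" by (auto simp: eventually_at_bot_linorder)
  have "\<forall>\<^sub>F z in at_top. \<beta> < g z"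
    using D(7) \<open>\<beta> < 1\<close> by (intro order_tendstoD) auto
  then obtain Z where Z: "\<And>z. Z \<le> z \<Longrightarrow> \<beta> < g z" by (auto simp: eventually_at_top_linorder)
  define A where "A = {z \<in> {Y..Z}. g z \<in> {\<alpha>..\<beta>}}"
  have mem: "z \<in> A" if "\<alpha> \<le> g z" "g z \<le> \<beta>" for z
    using Y[of z] Z[of z] that by (force simp: A_def)
  show thesis
  proof (cases "A = {}")
    case True
    then show ?thesis using that[of 1] mem by auto
  next
    case False
    have "continuous_on {Y..Z} g"
      using D(3) DERIV_isCont by (blast intro: continuous_at_imp_continuous_on)
    then have "closed ({Y..Z} \<inter> g -` {\<alpha>..\<beta>})"
      by (intro continuous_closed_preimage) auto
    moreover have "{Y..Z} \<inter> g -` {\<alpha>..\<beta>} = A" by (auto simp: A_def)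
    ultimately have "closed A" by simp
    moreover have "A \<subseteq> {Y..Z}" by (auto simp: A_def)
    ultimately have "compact A"
      by (meson bounded_closed_interval bounded_subset compact_eq_bounded_closed)
    moreover have "continuous_on A g'"
      using D(4) DERIV_isCont by (blast intro: continuous_at_imp_continuous_on)
    ultimately obtain y where y: "y \<in> A" "\<And>z. z \<in> A \<Longrightarrow> g' y \<le> g' z"
      using continuous_attains_inf[OF _ False] by blast
    have "0 < g' y"
      using y(1) front \<open>0 < \<alpha>\<close> \<open>\<beta> < 1\<close> unfolding A_def monotone_front_def by force
    then show ?thesis using that y(2) mem by blast
  qed
qed

section \<open>The reaction term near the two equilibria\<close>

text \<open>
  What the barriers use of \<open>f\<close>. On \<open>[\<beta>,1]\<close> it decreases at rate \<open>m\<close>, because \<open>f' 1 < 0\<close> and \<open>f'\<close> is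
  continuous. The condition on \<open>[0,\<alpha>]\<close> covers the bistable and the combustion case at once: if
  \<open>f = 0\<close> near \<open>0\<close> it is trivial, and if \<open>f\<close> decreases at rate \<open>k\<close> there it holds with \<open>K = L / k\<close>.
  Either way \<open>f\<close> is nonincreasing on \<open>[0,\<alpha>]\<close>, and lowering the argument by \<open>\<sigma>\<close> raises \<open>f\<close> by at least
  \<open>(\<sigma> / K) \<bar>f\<bar>\<close>, which beats every perturbation that is a small multiple of \<open>f\<close> itself.
\<close>

definition reaction_structure :: "(real \<Rightarrow> real) \<Rightarrow> real \<Rightarrow> real \<Rightarrow> real \<Rightarrow> real \<Rightarrow> real \<Rightarrow> bool" where
  "reaction_structure f L \<alpha> \<beta> K m \<longleftrightarrow>
     0 < L \<and> 0 < \<alpha> \<and> \<alpha> < \<beta> \<and> \<beta> < 1 \<and> 0 < K \<and> 0 < m \<and> f 0 = 0 \<and> f 1 = 0 \<and>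
     (\<forall>x y. 0 \<le> x \<and> x \<le> y \<and> y \<le> 1 \<longrightarrow> \<bar>f y - f x\<bar> \<le> L * (y - x)) \<and>
     (\<forall>x y. 0 \<le> x \<and> x \<le> y \<and> y \<le> \<alpha> \<longrightarrow> (y - x) * \<bar>f y\<bar> \<le> K * (f x - f y)) \<and>
     (\<forall>x y. \<beta> \<le> x \<and> x \<le> y \<and> y \<le> 1 \<longrightarrow> f y \<le> f x - m * (y - x))"

lemma hoelder_derivative_keeps_sign:
  fixes f' :: "real \<Rightarrow> real"
  assumes "f' p < 0" "0 < \<alpha>" "p \<in> I"
    and hoelder: "\<And>x y. x \<in> I \<Longrightarrow> y \<in> I \<Longrightarrow> \<bar>f' x - f' y\<bar> \<le> C * \<bar>x - y\<bar> powr \<alpha>"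
  obtains \<delta> where "0 < \<delta>" "\<And>x. x \<in> I \<Longrightarrow> \<bar>x - p\<bar> < \<delta> \<Longrightarrow> f' x \<le> f' p / 2"
proof -
  define D where "D = max C 1"
  define r where "r = - f' p / (2 * D)"
  define \<delta> where "\<delta> = r powr (1 / \<alpha>)"
  have D: "0 < D" by (simp add: D_def)
  have "0 < r" unfolding r_def using \<open>f' p < 0\<close> D by (intro divide_pos_pos) auto
  then have "0 < \<delta>" by (simp add: \<delta>_def)
  moreover have "f' x \<le> f' p / 2" if x: "x \<in> I" "\<bar>x - p\<bar> < \<delta>" for x
  proof -
    have "\<bar>x - p\<bar> powr \<alpha> \<le> \<delta> powr \<alpha>"
      using x \<open>0 < \<alpha>\<close> by (intro powr_mono2) auto
    also have "\<delta> powr \<alpha> = r"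
      using \<open>0 < r\<close> \<open>0 < \<alpha>\<close> by (simp add: \<delta>_def powr_powr)
    finally have "D * \<bar>x - p\<bar> powr \<alpha> \<le> - f' p / 2"
      using D by (simp add: r_def field_simps)
    moreover have "\<bar>f' x - f' p\<bar> \<le> D * \<bar>x - p\<bar> powr \<alpha>"
      using hoelder[OF x(1) \<open>p \<in> I\<close>] by (rule order_trans) (simp add: D_def mult_right_mono)
    ultimately show ?thesis by linarith
  qed
  ultimately show thesis by (rule that)
qed

lemma decrease_of_derivative_bound:
  fixes f :: "real \<Rightarrow> real"
  assumes "a \<le> b" and d: "\<And>x. x \<in> {a..b} \<Longrightarrow> (f has_real_derivative f' x) (at x within {a..b})"
    and le: "\<And>x. x \<in> {a..b} \<Longrightarrow> f' x \<le> - m"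
  shows "f b \<le> f a - m * (b - a)"
proof (cases "a = b")
  case False
  with \<open>a \<le> b\<close> have "a < b" by simp
  obtain z where z: "z \<in> {a<..<b}" "f b - f a = f' z * (b - a)"
    using mvt_simple[OF \<open>a < b\<close>, of f "\<lambda>x. (*) (f' x)"] d by (auto simp: has_field_derivative_def)
  have "f' z * (b - a) \<le> - m * (b - a)"
    using le[of z] z(1) \<open>a < b\<close> by (intro mult_right_mono) auto
  with z(2) show ?thesis by simp
qed simp

lemma reaction_structure_exists:
  assumes F1: "F1 f" and F2: "F2 f" and F4: "F4 f"
  obtains L \<alpha> \<beta> K m where "reaction_structure f L \<alpha> \<beta> K m"
proof -
  from F1 obtain L0 where L0: "L0-lipschitz_on {0..1} f" by (auto simp: F1_def)
  from F1 have f01: "f 0 = 0" "f 1 = 0" by (auto simp: F1_def)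
  from F1 obtain a \<gamma> f' C where a: "0 < a" and \<gamma>: "0 < \<gamma>" "\<gamma> < 1" and
    d: "\<And>x. x \<in> {0..<\<gamma>} \<union> {1-\<gamma><..1} \<Longrightarrow> (f has_real_derivative f' x) (at x within {0..1})" and
    hoelder: "\<And>x y. x \<in> {0..<\<gamma>} \<union> {1-\<gamma><..1} \<Longrightarrow> y \<in> {0..<\<gamma>} \<union> {1-\<gamma><..1} \<Longrightarrow>
      \<bar>f' x - f' y\<bar> \<le> C * \<bar>x - y\<bar> powr a"
    unfolding F1_def by blast
  define L where "L = max L0 1"
  have L: "0 < L" by (simp add: L_def)
  have lip: "\<bar>f y - f x\<bar> \<le> L * (y - x)" if "0 \<le> x" "x \<le> y" "y \<le> 1" for x y
  proof -
    have "\<bar>f y - f x\<bar> \<le> L0 * \<bar>y - x\<bar>"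
      using lipschitz_onD[OF L0, of y x] that by (simp add: dist_real_def)
    also have "\<dots> \<le> L * (y - x)" using that by (simp add: L_def mult_right_mono)
    finally show ?thesis .
  qed
  have unique: "f' p = D" if "(f has_real_derivative D) (at p within {0..1})" "p \<in> {0, 1}" for p D
  proof -
    have "at p within {0..1} \<noteq> bot"
      using that(2) by (auto simp: trivial_limit_within)
    moreover have "(f has_real_derivative f' p) (at p within {0..1})"
      using that(2) \<gamma> by (intro d) auto
    ultimately show ?thesis using that(1) has_field_derivative_unique by blast
  qed
  \<comment> \<open>Close to an end point with \<open>f' p < 0\<close>, the Hoelder condition keeps \<open>f'\<close> below \<open>f' p / 2\<close>.\<close>
  have decrease: "\<exists>\<delta>>0. \<exists>m>0. \<forall>x y. x \<le> y \<and> {x..y} \<subseteq> {0..1} \<inter> {p - \<delta>..p + \<delta>} \<longrightarrow> f y \<le> f x - m * (y - x)"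
    if "f' p < 0" "p \<in> {0, 1}" for p
  proof -
    let ?I = "{0..<\<gamma>} \<union> {1-\<gamma><..1}"
    have "p \<in> ?I" using that \<gamma> by auto
    from hoelder_derivative_keeps_sign[OF that(1) a this hoelder]
    obtain \<delta> where \<delta>: "0 < \<delta>" "\<And>x. x \<in> ?I \<Longrightarrow> \<bar>x - p\<bar> < \<delta> \<Longrightarrow> f' x \<le> f' p / 2" by blast
    define \<delta>' where "\<delta>' = min \<delta> \<gamma> / 2"
    have \<delta>': "0 < \<delta>'" "\<delta>' < \<delta>" "\<delta>' < \<gamma>" using \<delta> \<gamma> by (auto simp: \<delta>'_def)
    have "f y \<le> f x - (- f' p / 2) * (y - x)"
      if xy: "x \<le> y" "{x..y} \<subseteq> {0..1} \<inter> {p - \<delta>'..p + \<delta>'}" for x y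
    proof (rule decrease_of_derivative_bound[OF xy(1)])
      fix z assume z: "z \<in> {x..y}"
      then have z': "0 \<le> z" "z \<le> 1" "\<bar>z - p\<bar> \<le> \<delta>'" using xy(2) by (auto simp: abs_le_iff)
      then have "z \<in> ?I" using \<delta>' \<open>p \<in> {0, 1}\<close> by auto
      then show "(f has_real_derivative f' z) (at z within {x..y})" "f' z \<le> - (- f' p / 2)"
        using d[of z] \<delta>(2)[of z] xy(2) z' \<delta>' by (auto intro: has_field_derivative_subset)
    qed
    moreover have "0 < - f' p / 2" using \<open>f' p < 0\<close> by simp
    ultimately show ?thesis using \<delta>'(1) by blast
  qed

  have "f' 1 < 0" using F2 unique[of _ 1] by (auto simp: F2_def)
  from decrease[OF this] obtain \<delta> m where
    \<delta>: "0 < \<delta>" "0 < m" "\<And>x y. x \<le> y \<Longrightarrow> {x..y} \<subseteq> {0..1} \<inter> {1 - \<delta>..1 + \<delta>} \<Longrightarrow> f y \<le> f x - m * (y - x)"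
    by auto
  define \<beta> where "\<beta> = max (1 - \<delta>) (1 / 2)"
  have \<beta>: "1 / 2 \<le> \<beta>" "\<beta> < 1" using \<delta> by (auto simp: \<beta>_def)
  have near1: "f y \<le> f x - m * (y - x)" if "\<beta> \<le> x" "x \<le> y" "y \<le> 1" for x y
    using that \<delta> by (intro \<delta>(3)) (auto simp: \<beta>_def)

  have "\<exists>\<alpha> K. 0 < \<alpha> \<and> \<alpha> < 1 / 2 \<and> 0 < K \<and>
      (\<forall>x y. 0 \<le> x \<and> x \<le> y \<and> y \<le> \<alpha> \<longrightarrow> (y - x) * \<bar>f y\<bar> \<le> K * (f x - f y))"
  proof -
    from F4 obtain \<theta> where \<theta>: "0 < \<theta>" and
      "(\<exists>D<0. (f has_real_derivative D) (at 0 within {0..1})) \<or> (\<forall>s\<in>{0<..<\<theta>}. f s = 0)"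
      unfolding F4_def by blast
    then consider D where "D < 0" "(f has_real_derivative D) (at 0 within {0..1})"
      | "\<forall>s\<in>{0<..<\<theta>}. f s = 0" by blast
    then show ?thesis
    proof cases
      case 1
      then have "f' 0 < 0" using unique[of _ 0] by auto
      from decrease[OF this] obtain \<epsilon> k where
        \<epsilon>: "0 < \<epsilon>" "0 < k" "\<And>x y. x \<le> y \<Longrightarrow> {x..y} \<subseteq> {0..1} \<inter> {0 - \<epsilon>..0 + \<epsilon>} \<Longrightarrow> f y \<le> f x - k * (y - x)"
        by auto
      have "(y - x) * \<bar>f y\<bar> \<le> (L / k) * (f x - f y)"
        if "0 \<le> x" "x \<le> y" "y \<le> min \<epsilon> (1 / 4)" for x y
      proof -
        have "\<bar>f y\<bar> \<le> L * y" using lip[of 0 y] that f01 by simp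
        also have "\<dots> \<le> L" using that L by (simp add: mult_le_cancel_left1)
        finally have "(y - x) * \<bar>f y\<bar> \<le> (y - x) * L" using that by (intro mult_left_mono) auto
        moreover have "k * (y - x) \<le> f x - f y" using \<epsilon>(3)[of x y] that by auto
        then have "(L / k) * (k * (y - x)) \<le> (L / k) * (f x - f y)"
          using L \<epsilon>(2) by (intro mult_left_mono) auto
        ultimately show ?thesis using \<epsilon>(2) by (simp add: mult.commute)
      qed
      moreover have "0 < min \<epsilon> (1 / 4)" "min \<epsilon> (1 / 4) < 1 / 2" "0 < L / k" using \<epsilon> L by auto
      ultimately show ?thesis by blast
    next
      case 2
      have "f y = 0" if "0 \<le> y" "y \<le> min \<theta> (1 / 2) / 2" for y
        using 2 f01 that \<theta> by (cases "y = 0") auto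
      then have "(y - x) * \<bar>f y\<bar> \<le> 1 * (f x - f y)"
        if "0 \<le> x" "x \<le> y" "y \<le> min \<theta> (1 / 2) / 2" for x y
        using that by simp
      moreover have "0 < min \<theta> (1 / 2) / 2" "min \<theta> (1 / 2) / 2 < 1 / 2" using \<theta> by auto
      ultimately show ?thesis by (intro exI[of _ "min \<theta> (1 / 2) / 2"] exI[of _ 1]) auto
    qed
  qed
  then obtain \<alpha> K where \<alpha>: "0 < \<alpha>" "\<alpha> < 1 / 2" "0 < K"
    "\<And>x y. 0 \<le> x \<Longrightarrow> x \<le> y \<Longrightarrow> y \<le> \<alpha> \<Longrightarrow> (y - x) * \<bar>f y\<bar> \<le> K * (f x - f y)" by blast
  have "reaction_structure f L \<alpha> \<beta> K m"
    unfolding reaction_structure_def using L lip \<alpha> \<beta> \<delta>(2) near1 f01 by auto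
  then show thesis by (rule that)
qed

lemma reaction_structureD:
  assumes "reaction_structure f L \<alpha> \<beta> K m"
  shows "0 < L" "0 < \<alpha>" "\<alpha> < \<beta>" "\<beta> < 1" "0 < K" "0 < m"
    and "0 \<le> x \<Longrightarrow> x \<le> y \<Longrightarrow> y \<le> 1 \<Longrightarrow> \<bar>f y - f x\<bar> \<le> L * (y - x)"
    and "0 \<le> x \<Longrightarrow> x \<le> y \<Longrightarrow> y \<le> \<alpha> \<Longrightarrow> (y - x) * \<bar>f y\<bar> \<le> K * (f x - f y)"
    and "\<beta> \<le> x \<Longrightarrow> x \<le> y \<Longrightarrow> y \<le> 1 \<Longrightarrow> f y \<le> f x - m * (y - x)"
    and "0 \<le> x \<Longrightarrow> x \<le> 1 \<Longrightarrow> \<bar>f x\<bar> \<le> L"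
    and "0 \<le> x \<Longrightarrow> x \<le> \<alpha> \<Longrightarrow> f x \<le> 0"
    and "\<beta> \<le> x \<Longrightarrow> x \<le> 1 \<Longrightarrow> 0 \<le> f x"
proof -
  note S = assms[unfolded reaction_structure_def]
  show "0 < L" "0 < \<alpha>" "\<alpha> < \<beta>" "\<beta> < 1" "0 < K" "0 < m" using S by auto
  show "0 \<le> x \<Longrightarrow> x \<le> y \<Longrightarrow> y \<le> 1 \<Longrightarrow> \<bar>f y - f x\<bar> \<le> L * (y - x)"
    and near0: "0 \<le> x \<Longrightarrow> x \<le> y \<Longrightarrow> y \<le> \<alpha> \<Longrightarrow> (y - x) * \<bar>f y\<bar> \<le> K * (f x - f y)" for x y
    using S by auto
  show near1: "\<beta> \<le> x \<Longrightarrow> x \<le> y \<Longrightarrow> y \<le> 1 \<Longrightarrow> f y \<le> f x - m * (y - x)" for x y using S by auto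
  show "\<bar>f x\<bar> \<le> L" if "0 \<le> x" "x \<le> 1"
  proof -
    have "\<bar>f x - f 0\<bar> \<le> L * (x - 0)" using S that by blast
    also have "\<dots> \<le> L" using S that by (simp add: mult_le_cancel_left1)
    finally show ?thesis using S by simp
  qed
  show "f x \<le> 0" if "0 \<le> x" "x \<le> \<alpha>"
  proof -
    have "0 \<le> K * (f 0 - f x)" using near0[of 0 x] that by (smt (verit) mult_nonneg_nonneg)
    then show ?thesis using S by (simp add: mult_le_0_iff)
  qed
  show "0 \<le> f x" if "\<beta> \<le> x" "x \<le> 1"
  proof -
    have "f 1 \<le> f x - m * (1 - x)" using near1[of x 1] that by simp
    moreover have "0 \<le> m * (1 - x)" using S that by simp
    ultimately show ?thesis using S by simp
  qed
qed

section \<open>Differential inequalities for perturbed fronts\<close>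

text \<open>
  The function \<open>g (\<nu> t + N x) + \<sigma>\<close>, where \<open>A = \<bar>\<nabla>N\<bar>\<^sup>2\<close> and \<open>N\<close> in the statement stands for \<open>\<Delta>N\<close>, is a
  supersolution where it is below \<open>1\<close> exactly if the displayed inequality holds. The excess speed \<open>\<nu> - \<kappa>\<close> contributes a
  positive multiple of \<open>g'\<close>, which dominates where \<open>g\<close> stays away from \<open>0\<close> and \<open>1\<close>. Near \<open>1\<close> the gain
  \<open>m \<sigma>\<close> comes from the decrease of \<open>f\<close>, and near \<open>0\<close> nothing is lost because \<open>f\<close> is nonpositive and
  nonincreasing. There \<open>A\<close> may be any number in \<open>[0,1]\<close>; elsewhere \<open>A\<close> has to be close to \<open>1\<close>, and how
  close depends on \<open>\<sigma>\<close>, which is therefore fixed first.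
\<close>

lemma supersolution_inequality:
  assumes struct: "reaction_structure f L \<alpha> \<beta> K m" and front: "monotone_front f \<kappa> g g'"
    and \<kappa>: "0 < \<kappa>" "\<kappa> < \<nu>"
  obtains \<sigma>0 where "0 < \<sigma>0"
    "\<And>\<sigma>. 0 < \<sigma> \<Longrightarrow> \<sigma> \<le> \<sigma>0 \<Longrightarrow> \<exists>\<eta> Z. 0 < \<eta> \<and>
       (\<forall>z A N. 0 \<le> A \<and> A \<le> 1 \<and> (1 - \<eta> \<le> A \<or> z \<le> Z) \<and> 0 \<le> N \<and> N \<le> \<eta> \<and> g z + \<sigma> < 1 \<longrightarrow>
          f (g z + \<sigma>) \<le> (\<nu> - N - A * \<kappa>) * g' z + A * f (g z))"
proof -
  note S = reaction_structureD[OF struct] and D = monotone_frontD[OF front]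
  obtain p where p: "0 < p" "\<And>z. \<alpha> / 2 \<le> g z \<Longrightarrow> g z \<le> \<beta> \<Longrightarrow> p \<le> g' z"
    using monotone_front_slope_bound[OF front, of "\<alpha> / 2" \<beta>] S(2,4) by auto
  define q where "q = (\<nu> - \<kappa>) / 2"
  then have q: "0 < q" and q_eq: "\<kappa> = \<nu> - 2 * q" using \<kappa> by simp_all
  define \<sigma>0 where "\<sigma>0 = min (\<alpha> / 2) (q * p / (2 * L))"
  have "\<exists>\<eta> Z. 0 < \<eta> \<and>
       (\<forall>z A N. 0 \<le> A \<and> A \<le> 1 \<and> (1 - \<eta> \<le> A \<or> z \<le> Z) \<and> 0 \<le> N \<and> N \<le> \<eta> \<and> g z + \<sigma> < 1 \<longrightarrow>
          f (g z + \<sigma>) \<le> (\<nu> - N - A * \<kappa>) * g' z + A * f (g z))"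
    if \<sigma>: "0 < \<sigma>" "\<sigma> \<le> \<sigma>0" for \<sigma>
  proof -
    define \<eta> where "\<eta> = min q (min (m * \<sigma> / L) (q * p / (2 * L)))"
    have "\<eta> \<le> m * \<sigma> / L" "\<eta> \<le> q * p / (2 * L)" by (simp_all add: \<eta>_def)
    then have \<eta>: "0 < \<eta>" "\<eta> \<le> q" "\<eta> * L \<le> m * \<sigma>" "\<eta> * L \<le> q * p / 2"
      using q p(1) S(1,6) \<sigma>(1) by (auto simp: pos_le_divide_eq algebra_simps) (auto simp: \<eta>_def)
    have \<sigma>L: "L * \<sigma> \<le> q * p / 2" "\<sigma> \<le> \<alpha> / 2"
      using \<sigma>(2) S(1) by (auto simp: \<sigma>0_def field_simps)
    have "\<forall>\<^sub>F z in at_bot. g z < \<alpha> / 2"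
      using D(6) S(2) by (intro order_tendstoD) auto
    then obtain Z where Z: "\<And>z. z \<le> Z \<Longrightarrow> g z < \<alpha> / 2" by (auto simp: eventually_at_bot_linorder)
    have "f (g z + \<sigma>) \<le> (\<nu> - N - A * \<kappa>) * g' z + A * f (g z)"
      if A: "0 \<le> A" "A \<le> 1" "1 - \<eta> \<le> A \<or> z \<le> Z" and N: "0 \<le> N" "N \<le> \<eta>" and lt: "g z + \<sigma> < 1"
      for z A N
    proof -
      have "A * \<kappa> \<le> \<kappa>" using A \<kappa> by (simp add: mult_le_cancel_right2)
      then have "q \<le> \<nu> - N - A * \<kappa>" using N \<eta>(2) q_eq by linarith
      then have slope: "q * g' z \<le> (\<nu> - N - A * \<kappa>) * g' z"
        using D(5) by (intro mult_right_mono) auto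
      have "0 \<le> q * g' z" using q D(5) by simp
      have defect: "- (\<eta> * L) \<le> A * f (g z) - f (g z)" if "1 - \<eta> \<le> A"
      proof -
        have "(1 - A) * f (g z) \<le> (1 - A) * L"
          using S(10)[of "g z"] D(1,2) A by (intro mult_left_mono) (auto simp: abs_le_iff)
        also have "\<dots> \<le> \<eta> * L" using that S(1) by (intro mult_right_mono) auto
        finally show ?thesis by (simp add: algebra_simps)
      qed
      consider "g z < \<alpha> / 2" | "1 - \<eta> \<le> A" "\<alpha> / 2 \<le> g z" "g z \<le> \<beta>" | "1 - \<eta> \<le> A" "\<beta> \<le> g z"
        using A(3) Z[of z] by linarith
      then show ?thesis
      proof cases
        case 1
        have "K * f (g z + \<sigma>) \<le> K * f (g z)"
          using S(8)[of "g z" "g z + \<sigma>"] D(1)[of z] \<sigma>(1) \<sigma>L 1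
          by (smt (verit) mult_nonneg_nonneg right_diff_distrib field_sum_of_halves)
        then have "f (g z + \<sigma>) \<le> f (g z)" using S(5) by simp
        also have "\<dots> \<le> A * f (g z)"
          using S(11)[of "g z"] D(1)[of z] 1 S(2) A mult_right_mono_neg[of A 1 "f (g z)"] by simp
        finally show ?thesis using slope \<open>0 \<le> q * g' z\<close> by linarith
      next
        case 2
        have "f (g z + \<sigma>) - f (g z) \<le> L * \<sigma>"
          using S(7)[of "g z" "g z + \<sigma>"] D(1)[of z] \<sigma>(1) lt by auto
        moreover have "q * p \<le> q * g' z" using p(2) 2 q by simp
        ultimately show ?thesis using defect[OF 2(1)] slope \<sigma>L \<eta> by linarith
      next
        case 3
        have "f (g z + \<sigma>) \<le> f (g z) - m * \<sigma>"
          using S(9)[of "g z" "g z + \<sigma>"] \<sigma>(1) lt 3 by auto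
        then show ?thesis using defect[OF 3(1)] slope \<open>0 \<le> q * g' z\<close> \<eta> by linarith
      qed
    qed
    then show ?thesis using \<eta>(1) by blast
  qed
  moreover have "0 < \<sigma>0" using S(1,2) p q by (simp add: \<sigma>0_def)
  ultimately show thesis using that by blast
qed

text \<open>
  The counterpart for \<open>g (\<nu> t - N x) - \<sigma>\<close> with too small a speed \<open>\<nu>\<close>. The two equilibria now play
  different roles: the values of \<open>A\<close> far from \<open>1\<close> have to be admitted near the equilibrium \<open>1\<close>, where
  the coefficient of \<open>g'\<close> may have the wrong sign. It is compensated by \<open>m \<sigma>\<close>, since \<open>g'\<close> tends
  to \<open>0\<close>.
\<close>

lemma subsolution_inequality:
  assumes struct: "reaction_structure f L \<alpha> \<beta> K m" and front: "monotone_front f \<kappa> g g'"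
    and \<nu>: "0 < \<nu>" "\<nu> < \<kappa>"
  obtains \<sigma>0 where "0 < \<sigma>0"
    "\<And>\<sigma>. 0 < \<sigma> \<Longrightarrow> \<sigma> \<le> \<sigma>0 \<Longrightarrow> \<exists>\<eta> Z. 0 < \<eta> \<and>
       (\<forall>z A N. 0 \<le> A \<and> A \<le> 1 \<and> (1 - \<eta> \<le> A \<or> Z \<le> z) \<and> 0 \<le> N \<and> N \<le> \<eta> \<and> 0 < g z - \<sigma> \<longrightarrow>
          (\<nu> + N - A * \<kappa>) * g' z + A * f (g z) \<le> f (g z - \<sigma>))"
proof -
  note S = reaction_structureD[OF struct] and D = monotone_frontD[OF front]
  define \<beta>' where "\<beta>' = (1 + \<beta>) / 2"
  have \<beta>': "\<beta> < \<beta>'" "\<beta>' < 1" using S(4) by (auto simp: \<beta>'_def)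
  obtain p where p: "0 < p" "\<And>z. \<alpha> \<le> g z \<Longrightarrow> g z \<le> \<beta>' \<Longrightarrow> p \<le> g' z"
    using monotone_front_slope_bound[OF front S(2) \<beta>'(2)] by auto
  define q where "q = (\<kappa> - \<nu>) / 2"
  then have q: "0 < q" and q_eq: "\<kappa> = \<nu> + 2 * q" using \<nu> by simp_all
  define \<sigma>0 where "\<sigma>0 = min (\<beta>' - \<beta>) (q * p / (2 * L))"
  have "\<exists>\<eta> Z. 0 < \<eta> \<and>
       (\<forall>z A N. 0 \<le> A \<and> A \<le> 1 \<and> (1 - \<eta> \<le> A \<or> Z \<le> z) \<and> 0 \<le> N \<and> N \<le> \<eta> \<and> 0 < g z - \<sigma> \<longrightarrow>
          (\<nu> + N - A * \<kappa>) * g' z + A * f (g z) \<le> f (g z - \<sigma>))"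
    if \<sigma>: "0 < \<sigma>" "\<sigma> \<le> \<sigma>0" for \<sigma>
  proof -
    define \<eta> where "\<eta> = min (min 1 (q / (1 + \<kappa>))) (min (\<sigma> / K) (q * p / (2 * L)))"
    have \<kappa>: "0 < \<kappa>" using \<nu> by simp
    have "\<eta> \<le> q / (1 + \<kappa>)" "\<eta> \<le> \<sigma> / K" "\<eta> \<le> q * p / (2 * L)" by (simp_all add: \<eta>_def)
    then have \<eta>: "0 < \<eta>" "\<eta> \<le> 1" "\<eta> * (1 + \<kappa>) \<le> q" "\<eta> * K \<le> \<sigma>" "\<eta> * L \<le> q * p / 2"
      using q p(1) S(1,5) \<sigma>(1) \<kappa> by (auto simp: pos_le_divide_eq algebra_simps) (auto simp: \<eta>_def min_le_iff_disj)
    have \<sigma>L: "L * \<sigma> \<le> q * p / 2" "\<sigma> \<le> \<beta>' - \<beta>"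
      using \<sigma>(2) S(1) by (auto simp: \<sigma>0_def field_simps)
    have "\<forall>\<^sub>F z in at_top. \<beta>' < g z \<and> g' z < m * \<sigma> / (\<nu> + 1)"
      using D(7,8) \<beta>'(2) S(6) \<sigma>(1) \<nu>(1)
      by (intro eventually_conj order_tendstoD) auto
    then obtain Z where Z: "\<And>z. Z \<le> z \<Longrightarrow> \<beta>' < g z" "\<And>z. Z \<le> z \<Longrightarrow> g' z < m * \<sigma> / (\<nu> + 1)"
      by (auto simp: eventually_at_top_linorder)
    have "(\<nu> + N - A * \<kappa>) * g' z + A * f (g z) \<le> f (g z - \<sigma>)"
      if A: "0 \<le> A" "A \<le> 1" "1 - \<eta> \<le> A \<or> Z \<le> z" and N: "0 \<le> N" "N \<le> \<eta>" and pos: "0 < g z - \<sigma>"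
      for z A N
    proof -
      have slope: "(\<nu> + N - A * \<kappa>) * g' z \<le> - q * g' z" "0 \<le> q * g' z" if "1 - \<eta> \<le> A"
      proof -
        have "(1 - \<eta>) * \<kappa> \<le> A * \<kappa>" using that \<kappa> by simp
        then have "\<kappa> - \<eta> * \<kappa> \<le> A * \<kappa>" "\<eta> + \<eta> * \<kappa> \<le> q" using \<eta>(3) by (simp_all add: algebra_simps)
        then have "\<nu> + N - A * \<kappa> \<le> - q" using N q_eq by linarith
        then show "(\<nu> + N - A * \<kappa>) * g' z \<le> - q * g' z"
          using D(5) by (intro mult_right_mono) auto
        show "0 \<le> q * g' z" using q D(5) by simp
      qed
      have defect: "A * f (g z) - f (g z) \<le> \<eta> * \<bar>f (g z)\<bar>" if "1 - \<eta> \<le> A"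
      proof -
        have "(1 - A) * (- f (g z)) \<le> (1 - A) * \<bar>f (g z)\<bar>"
          using A by (intro mult_left_mono) auto
        also have "\<dots> \<le> \<eta> * \<bar>f (g z)\<bar>" using that by (intro mult_right_mono) auto
        finally show ?thesis by (simp add: algebra_simps)
      qed
      have near1: "A * f (g z) \<le> f (g z - \<sigma>) - m * \<sigma>" if "\<beta>' \<le> g z"
      proof -
        have "A * f (g z) \<le> f (g z)"
          using S(12)[of "g z"] D(2) that \<beta>' A by (simp add: mult_left_le_one_le)
        moreover have "f (g z) \<le> f (g z - \<sigma>) - m * \<sigma>"
          using S(9)[of "g z - \<sigma>" "g z"] D(2) that \<sigma>L \<sigma>(1) by simp
        ultimately show ?thesis by simp
      qed
      have "0 \<le> m * \<sigma>" using S(6) \<sigma>(1) by simp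
      consider "1 - \<eta> \<le> A" "g z \<le> \<alpha>" | "1 - \<eta> \<le> A" "\<alpha> \<le> g z" "g z \<le> \<beta>'"
        | "1 - \<eta> \<le> A" "\<beta>' \<le> g z" | "Z \<le> z"
        using A(3) by linarith
      then show ?thesis
      proof cases
        case 1
        have "K * (\<eta> * \<bar>f (g z)\<bar>) \<le> \<sigma> * \<bar>f (g z)\<bar>"
          using mult_right_mono[OF \<eta>(4), of "\<bar>f (g z)\<bar>"] by (simp add: ac_simps)
        also have "\<dots> \<le> K * (f (g z - \<sigma>) - f (g z))"
          using S(8)[of "g z - \<sigma>" "g z"] 1 pos \<sigma>(1) by simp
        finally have "\<eta> * \<bar>f (g z)\<bar> \<le> f (g z - \<sigma>) - f (g z)" using S(5) by simp
        then show ?thesis using defect[OF 1(1)] slope[OF 1(1)] by linarith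
      next
        case 2
        have "f (g z) - f (g z - \<sigma>) \<le> L * \<sigma>"
          using S(7)[of "g z - \<sigma>" "g z"] D(2)[of z] \<sigma>(1) pos by auto
        moreover have "q * p \<le> q * g' z" using p(2) 2 q by simp
        moreover have "\<eta> * \<bar>f (g z)\<bar> \<le> \<eta> * L" using S(10)[of "g z"] D(1,2) \<eta>(1) by simp
        ultimately show ?thesis using defect[OF 2(1)] slope(1)[OF 2(1)] \<sigma>L \<eta> by linarith
      next
        case 3
        then show ?thesis using near1[OF 3(2)] slope[OF 3(1)] \<open>0 \<le> m * \<sigma>\<close> by linarith
      next
        case 4
        have "\<nu> + N - A * \<kappa> \<le> \<nu> + 1" using A(1) \<kappa> N \<eta>(2) by (simp add: add_increasing2 algebra_simps) 
        then have "(\<nu> + N - A * \<kappa>) * g' z \<le> (\<nu> + 1) * g' z" using D(5) by (intro mult_right_mono) auto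
        also have "\<dots> \<le> m * \<sigma>" using Z(2)[OF 4] \<nu>(1) by (simp add: field_simps)
        finally show ?thesis using near1 Z(1)[OF 4] by simp
      qed
    qed
    then show ?thesis using \<eta>(1) by blast
  qed
  moreover have "0 < \<sigma>0" using S(1) p q \<beta>' by (simp add: \<sigma>0_def)
  ultimately show thesis using that by blast
qed

section \<open>Comparison with spherical fronts\<close>

lemma has_real_derivative_partial_x:
  assumes "partially_differentiable_x i w"
  shows "((\<lambda>s. w (x + s *\<^sub>R axis i 1, t)) has_real_derivative
      partial_x i w (x + s *\<^sub>R axis i 1, t)) (at s)"
proof -
  have "((\<lambda>r. w ((x + s *\<^sub>R axis i 1) + r *\<^sub>R axis i 1, t)) has_real_derivative
      partial_x i w (x + s *\<^sub>R axis i 1, t)) (at 0)"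
    using assms unfolding partially_differentiable_x_def partial_x_def
    by (simp add: DERIV_deriv_iff_real_differentiable)
  then have "((\<lambda>r. w (x + (r + s) *\<^sub>R axis i 1, t)) has_real_derivative
      partial_x i w (x + s *\<^sub>R axis i 1, t)) (at 0)"
    by (simp add: scaleR_add_left ac_simps)
  then show ?thesis
    using DERIV_shift[of "\<lambda>r. w (x + r *\<^sub>R axis i 1, t)" _ 0 s] by simp
qed

lemma has_real_derivative_partial_t:
  assumes "C21 w"
  shows "((\<lambda>\<tau>. w (x, \<tau>)) has_real_derivative partial_t w (x, t)) (at t)"
  using assms by (simp add: C21_def partial_t_def DERIV_deriv_iff_real_differentiable)

text \<open>
  A norm smoothed at the origin on the scale \<open>\<rho>\<close>: its gradient has length at most \<open>1\<close>, nearly \<open>1\<close> far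
  from the origin, and its Laplacian lies between \<open>0\<close> and \<open>n / \<rho>\<close>.
\<close>

definition smoothed_norm :: "real \<Rightarrow> 'a::real_normed_vector \<Rightarrow> real" where
  "smoothed_norm \<rho> x = sqrt (\<rho>\<^sup>2 + (norm x)\<^sup>2)"

lemma smoothed_norm_bounds:
  assumes "0 < \<rho>"
  shows "0 < smoothed_norm \<rho> x" "\<rho> \<le> smoothed_norm \<rho> x" "norm x \<le> smoothed_norm \<rho> x"
    "smoothed_norm \<rho> x \<le> \<rho> + norm x" "(smoothed_norm \<rho> x)\<^sup>2 = \<rho>\<^sup>2 + (norm x)\<^sup>2"
proof -
  have "0 < \<rho>\<^sup>2 + (norm x)\<^sup>2" using assms by (simp add: add_pos_nonneg)
  then show "0 < smoothed_norm \<rho> x" "(smoothed_norm \<rho> x)\<^sup>2 = \<rho>\<^sup>2 + (norm x)\<^sup>2"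
    by (simp_all add: smoothed_norm_def)
  show "\<rho> \<le> smoothed_norm \<rho> x" "norm x \<le> smoothed_norm \<rho> x"
    unfolding smoothed_norm_def by (simp_all add: real_le_rsqrt)
  show "smoothed_norm \<rho> x \<le> \<rho> + norm x"
    unfolding smoothed_norm_def using assms
    by (intro real_le_lsqrt) (auto simp: power2_sum)
qed

lemma smoothed_norm_derivatives:
  fixes x :: "real^'n::finite"
  assumes "0 < \<rho>"
  shows "((\<lambda>s. smoothed_norm \<rho> (x + s *\<^sub>R axis i 1)) has_real_derivative
      (x $ i + s) / smoothed_norm \<rho> (x + s *\<^sub>R axis i 1)) (at s)"
    and "((\<lambda>s. (x $ i + s) / smoothed_norm \<rho> (x + s *\<^sub>R axis i 1)) has_real_derivative
      1 / smoothed_norm \<rho> x - (x $ i)\<^sup>2 / smoothed_norm \<rho> x ^ 3) (at 0)"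
proof -
  let ?N = "\<lambda>s. smoothed_norm \<rho> (x + s *\<^sub>R axis i 1)"
  have eq: "?N s = sqrt (\<rho>\<^sup>2 + (norm x)\<^sup>2 + 2 * s * x $ i + s\<^sup>2)" for s
    unfolding smoothed_norm_def power2_norm_eq_inner
    by (simp add: inner_add_left inner_add_right inner_axis inner_axis' power2_eq_square distrib_left)
  have pos: "0 < ?N s" for s using smoothed_norm_bounds[OF assms] by blast
  show d: "(?N has_real_derivative (x $ i + s) / ?N s) (at s)" for s
  proof -
    have "0 < \<rho>\<^sup>2 + (norm x)\<^sup>2 + 2 * s * x $ i + s\<^sup>2"
      using pos[of s] by (simp add: eq)
    then show ?thesis unfolding eq
      by (auto intro!: derivative_eq_intros simp: field_simps)
  qed
  have "((\<lambda>s. (x $ i + s) / ?N s) has_real_derivative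
      (1 * ?N 0 - (x $ i + 0) * ((x $ i + 0) / ?N 0)) / (?N 0 * ?N 0)) (at 0)"
    using pos[of 0] by (intro DERIV_divide d) (auto intro!: derivative_eq_intros)
  also have "(1 * ?N 0 - (x $ i + 0) * ((x $ i + 0) / ?N 0)) / (?N 0 * ?N 0)
      = 1 / smoothed_norm \<rho> x - (x $ i)\<^sup>2 / smoothed_norm \<rho> x ^ 3"
    using pos[of 0] by (simp add: field_simps power2_eq_square power3_eq_cube)
  finally show "((\<lambda>s. (x $ i + s) / ?N s) has_real_derivative
      1 / smoothed_norm \<rho> x - (x $ i)\<^sup>2 / smoothed_norm \<rho> x ^ 3) (at 0)" .
qed

text \<open>
  The sign \<open>\<epsilon> = 1\<close> gives a contracting front shifted up by \<open>\<sigma>\<close>, a supersolution; \<open>\<epsilon> = - 1\<close> gives an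
  expanding front shifted down by \<open>\<sigma>\<close>, a subsolution. In both cases the equilibrium \<open>1\<close> lies behind
  the front, which moves with speed \<open>\<nu>\<close>.
\<close>

definition spherical_barrier ::
    "(real \<Rightarrow> real) \<Rightarrow> real \<Rightarrow> real \<Rightarrow> real \<Rightarrow> real \<Rightarrow> real \<Rightarrow> real^'n::finite \<Rightarrow> (real^'n) \<times> real \<Rightarrow> real" where
  "spherical_barrier g \<epsilon> \<sigma> \<nu> c \<rho> y p =
     g (\<nu> * (snd p - c) + \<epsilon> * smoothed_norm \<rho> (fst p - y)) + \<epsilon> * \<sigma>"

text \<open>
  Multiplying by the sign \<open>\<epsilon>\<close> treats the upper and the lower barrier together: the maximum principle
  is applied to \<open>v = \<epsilon> (u - W)\<close> for the barrier \<open>W\<close>. In the differential inequality \<open>A\<close> stands for the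
  squared length of the gradient of the smoothed norm \<open>N\<close> and \<open>M\<close> for its Laplacian. The inequality
  is needed only where \<open>W\<close> takes values in \<open>(0,1)\<close>: where \<open>v > 0\<close>, the bound \<open>0 < u < 1\<close> keeps \<open>W\<close> off
  one equilibrium, and the sign of the shift keeps it off the other.
\<close>

lemma spherical_barrier_comparison:
  fixes u :: "(real^'n::finite) \<times> real \<Rightarrow> real" and y :: "real^'n" and \<nu> c \<rho> :: real
  defines "N \<equiv> \<lambda>x. smoothed_norm \<rho> (x - y)"
  assumes struct: "reaction_structure f L \<alpha> \<beta> K m" and front: "monotone_front f \<kappa> g g'"
    and u: "entire_solution f u"
    and \<epsilon>: "\<epsilon> = 1 \<or> \<epsilon> = - 1" and \<sigma>: "0 < \<sigma>" and \<rho>: "0 < \<rho>" "real CARD('n) \<le> \<eta> * \<rho>"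
    and initial: "\<And>x. x \<in> cball y R \<Longrightarrow> \<epsilon> * u (x, T0) \<le> \<epsilon> * spherical_barrier g \<epsilon> \<sigma> \<nu> c \<rho> y (x, T0)"
    and lateral: "\<And>x t. dist y x = R \<Longrightarrow> T0 \<le> t \<Longrightarrow> t \<le> T1 \<Longrightarrow>
      \<epsilon> * u (x, t) \<le> \<epsilon> * spherical_barrier g \<epsilon> \<sigma> \<nu> c \<rho> y (x, t)"
    and ineq: "\<And>x t z A M. T0 \<le> t \<Longrightarrow> t \<le> T1 \<Longrightarrow> z = \<nu> * (t - c) + \<epsilon> * N x \<Longrightarrow>
      0 \<le> A \<Longrightarrow> A \<le> 1 \<Longrightarrow> 1 - A = \<rho>\<^sup>2 / (N x)\<^sup>2 \<Longrightarrow> 0 \<le> M \<Longrightarrow> M \<le> \<eta> \<Longrightarrow>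
      0 < g z + \<epsilon> * \<sigma> \<Longrightarrow> g z + \<epsilon> * \<sigma> < 1 \<Longrightarrow>
      \<epsilon> * f (g z + \<epsilon> * \<sigma>) \<le> \<epsilon> * ((\<nu> - \<epsilon> * M - A * \<kappa>) * g' z + A * f (g z))"
    and x: "x \<in> cball y R" and t: "T0 \<le> t" "t \<le> T1"
  shows "\<epsilon> * u (x, t) \<le> \<epsilon> * spherical_barrier g \<epsilon> \<sigma> \<nu> c \<rho> y (x, t)"
proof -
  note S = reaction_structureD[OF struct] and D = monotone_frontD[OF front]
  define W where "W = spherical_barrier g \<epsilon> \<sigma> \<nu> c \<rho> y"
  define \<zeta> where "\<zeta> x t = \<nu> * (t - c) + \<epsilon> * N x" for x t
  have W: "W (x, t) = g (\<zeta> x t) + \<epsilon> * \<sigma>" for x t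
    by (simp add: W_def \<zeta>_def N_def spherical_barrier_def)
  define v where "v p = \<epsilon> * (u p - W p)" for p
  have C21: "C21 u" and range: "\<And>p. 0 < u p" "\<And>p. u p < 1"
    and pde: "\<And>p. partial_t u p - laplace_x u p = f (u p)"
    using u by (auto simp: entire_solution_def)
  have \<epsilon>\<epsilon>: "\<epsilon> * \<epsilon> = 1" "\<epsilon>\<^sup>2 = 1" using \<epsilon> by auto
  note Nb = smoothed_norm_bounds[OF \<rho>(1)]
  have "continuous_on UNIV u" using C21 by (simp add: C21_def)
  moreover have contg: "continuous_on UNIV g"
    using D(3) DERIV_isCont by (blast intro: continuous_at_imp_continuous_on)
  have "continuous_on UNIV W"
    unfolding W_def spherical_barrier_def[abs_def] smoothed_norm_def
    by (intro continuous_intros continuous_on_compose2[OF contg]) auto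
  ultimately have "continuous_on UNIV v" unfolding v_def by (intro continuous_intros)
  then have cont: "continuous_on (cball y R \<times> {T0..T1}) v" by (rule continuous_on_subset) simp
  have "v (x, t) \<le> 0"
  proof (rule parabolic_maximum_principle[OF cont _ _ _ x t, of L])
    show "v (x, T0) \<le> 0" if "x \<in> cball y R" for x
      using initial[OF that] by (simp add: v_def W_def right_diff_distrib)
    show "v (x, t) \<le> 0" if "dist y x = R" "T0 \<le> t" "t \<le> T1" for x t
      using lateral[OF that] by (simp add: v_def W_def right_diff_distrib)
    fix x t assume pos: "0 < v (x, t)" and "dist y x < R" and t: "T0 < t" "t \<le> T1"
    define n where "n i s = (x $ i - y $ i + s) / N (x + s *\<^sub>R axis i 1)" for i s
    define n' where "n' i = 1 / N x - (x $ i - y $ i)\<^sup>2 / N x ^ 3" for i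
    define z where "z = \<zeta> x t"
    have dN: "((\<lambda>s. N (x + s *\<^sub>R axis i 1)) has_real_derivative n i s) (at s)" for i s
      using smoothed_norm_derivatives(1)[OF \<rho>(1), of "x - y" i s] by (simp add: N_def n_def algebra_simps)
    have dn: "(n i has_real_derivative n' i) (at 0)" for i
      using smoothed_norm_derivatives(2)[OF \<rho>(1), of "x - y" i]
      by (simp add: N_def n_def[abs_def] n'_def algebra_simps)
    have d\<zeta>: "((\<lambda>s. \<zeta> (x + s *\<^sub>R axis i 1) t) has_real_derivative \<epsilon> * n i s) (at s)" for i s
      unfolding \<zeta>_def by (auto intro!: derivative_eq_intros dN)
    let ?a = "\<epsilon> * (partial_t u (x, t) - \<nu> * g' z)"
    let ?d = "\<lambda>i s. \<epsilon> * (partial_x i u (x + s *\<^sub>R axis i 1, t)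
      - g' (\<zeta> (x + s *\<^sub>R axis i 1) t) * (\<epsilon> * n i s))"
    let ?e = "\<lambda>i. \<epsilon> * (partial_x i (partial_x i u) (x, t)
      - ((\<kappa> * g' z - f (g z)) * (n i 0)\<^sup>2 + g' z * (\<epsilon> * n' i)))"
    have "((\<lambda>\<tau>. v (x, \<tau>)) has_real_derivative ?a) (at t)"
    proof -
      have "((\<lambda>\<tau>. \<zeta> x \<tau>) has_real_derivative \<nu>) (at t)"
        unfolding \<zeta>_def by (auto intro!: derivative_eq_intros)
      then have "((\<lambda>\<tau>. g (\<zeta> x \<tau>)) has_real_derivative g' z * \<nu>) (at t)"
        unfolding z_def by (rule DERIV_chain2[OF D(3)])
      then show ?thesis unfolding v_def W
        by (auto intro!: derivative_eq_intros has_real_derivative_partial_t[OF C21])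
    qed
    moreover have "((\<lambda>s. v (x + s *\<^sub>R axis i 1, t)) has_real_derivative ?d i s) (at s)" for i s
    proof -
      have "partially_differentiable_x i u" using C21 by (simp add: C21_def)
      from has_real_derivative_partial_x[OF this, of x t s] DERIV_chain2[OF D(3) d\<zeta>[of i s]]
      show ?thesis unfolding v_def W by (auto intro!: derivative_eq_intros)
    qed
    moreover have "(?d i has_real_derivative ?e i) (at 0)" for i
    proof -
      have "partially_differentiable_x i (partial_x i u)" using C21 by (simp add: C21_def)
      from has_real_derivative_partial_x[OF this, of x t 0]
      have d2u: "((\<lambda>s. partial_x i u (x + s *\<^sub>R axis i 1, t)) has_real_derivative
        partial_x i (partial_x i u) (x, t)) (at 0)" by simp
      have "((\<lambda>s. g' (\<zeta> (x + s *\<^sub>R axis i 1) t)) has_real_derivative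
          (\<kappa> * g' z - f (g z)) * (\<epsilon> * n i 0)) (at 0)"
        using DERIV_chain2[OF D(4) d\<zeta>[of i 0]] by (simp add: z_def)
      from DERIV_mult[OF this DERIV_cmult[OF dn[of i], of \<epsilon>]]
      have "((\<lambda>s. g' (\<zeta> (x + s *\<^sub>R axis i 1) t) * (\<epsilon> * n i s)) has_real_derivative
          (\<kappa> * g' z - f (g z)) * (\<epsilon> * n i 0) * (\<epsilon> * n i 0) + \<epsilon> * n' i * g' z) (at 0)"
        by (simp add: z_def)
      also have "(\<kappa> * g' z - f (g z)) * (\<epsilon> * n i 0) * (\<epsilon> * n i 0) + \<epsilon> * n' i * g' z
          = (\<kappa> * g' z - f (g z)) * (n i 0)\<^sup>2 * (\<epsilon> * \<epsilon>) + g' z * (\<epsilon> * n' i)"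
        by (simp add: power2_eq_square ac_simps)
      finally show ?thesis unfolding \<epsilon>\<epsilon>(1) mult_1_right
        by (intro DERIV_cmult DERIV_diff d2u)
    qed
    moreover have "?a \<le> (\<Sum>i\<in>UNIV. ?e i) + L * v (x, t)"
    proof -
      define A where "A = (norm (x - y))\<^sup>2 / (N x)\<^sup>2"
      define M where "M = CARD('n) / N x - (norm (x - y))\<^sup>2 / N x ^ 3"
      have Npos: "0 < N x" "\<rho> \<le> N x" and N2: "(N x)\<^sup>2 = \<rho>\<^sup>2 + (norm (x - y))\<^sup>2"
        using Nb by (auto simp: N_def)
      have sq: "(norm (x - y))\<^sup>2 = (\<Sum>i\<in>UNIV. (x $ i - y $ i)\<^sup>2)"
        by (simp add: norm_vec_def L2_set_def sum_nonneg)
      have sumA: "(\<Sum>i\<in>UNIV. (n i 0)\<^sup>2) = A"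
        by (simp add: n_def A_def sq power_divide sum_divide_distrib)
      have sumM: "(\<Sum>i\<in>UNIV. n' i) = M"
        by (simp add: n'_def M_def sq sum_subtractf sum_divide_distrib)
      have A: "0 \<le> A" "A \<le> 1" "1 - A = \<rho>\<^sup>2 / (N x)\<^sup>2"
      proof -
        have p: "0 < (N x)\<^sup>2" using Npos(1) by simp
        then show "0 \<le> A" "A \<le> 1" by (simp_all add: A_def) (simp add: N2)
        have "1 - A = ((N x)\<^sup>2 - (norm (x - y))\<^sup>2) / (N x)\<^sup>2"
          using p by (simp add: A_def diff_divide_distrib)
        then show "1 - A = \<rho>\<^sup>2 / (N x)\<^sup>2" by (simp add: N2)
      qed
      have "(norm (x - y))\<^sup>2 / N x ^ 3 = A / N x" by (simp add: A_def power2_eq_square power3_eq_cube)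
      then have M_eq: "M = (CARD('n) - A) / N x" by (simp add: M_def diff_divide_distrib)
      have "1 \<le> real CARD('n)" by (simp add: Suc_leI)
      then have M: "0 \<le> M" unfolding M_eq using A(2) Npos(1) by (intro divide_nonneg_pos) linarith+
      have "0 \<le> \<eta>"
        using \<rho> \<open>1 \<le> real CARD('n)\<close> by (smt (verit) mult_neg_pos)
      then have "real CARD('n) - A \<le> \<eta> * N x"
        using \<rho>(2) A(1) mult_left_mono[OF Npos(2), of \<eta>] by linarith
      then have "M \<le> \<eta>" using Npos by (simp add: M_eq divide_le_eq)
      have between: "0 < W (x, t)" "W (x, t) < 1"
        using \<epsilon> pos range[of "(x, t)"] D(1,2)[of z] \<sigma> by (auto simp: v_def W z_def)
      have super: "\<epsilon> * f (W (x, t)) \<le> \<epsilon> * ((\<nu> - \<epsilon> * M - A * \<kappa>) * g' z + A * f (g z))"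
        using ineq[of t z x A M] t A M \<open>M \<le> \<eta>\<close> between by (simp add: z_def W \<zeta>_def)
      have "(\<Sum>i\<in>UNIV. ?e i) = \<epsilon> * (laplace_x u (x, t) - ((\<kappa> * g' z - f (g z)) * A + g' z * (\<epsilon> * M)))"
        unfolding sumA[symmetric] sumM[symmetric] laplace_x_def
        by (simp add: sum_distrib_left[symmetric] sum_subtractf sum.distrib)
      then have "?a - (\<Sum>i\<in>UNIV. ?e i)
          = \<epsilon> * f (u (x, t)) - \<epsilon> * ((\<nu> - \<epsilon> * M - A * \<kappa>) * g' z + A * f (g z))"
        unfolding pde[symmetric] by (simp add: algebra_simps)
      also have "\<dots> \<le> \<epsilon> * (f (u (x, t)) - f (W (x, t)))" using super by (simp add: algebra_simps)
      also have "\<dots> \<le> L * v (x, t)"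
        using \<epsilon> pos S(7)[of "W (x, t)" "u (x, t)"] S(7)[of "u (x, t)" "W (x, t)"] between range[of "(x, t)"]
        by (auto simp: v_def)
      finally show ?thesis by simp
    qed
    ultimately show "\<exists>a d e. ((\<lambda>\<tau>. v (x, \<tau>)) has_real_derivative a) (at t) \<and>
        (\<forall>i s. ((\<lambda>s. v (x + s *\<^sub>R axis i 1, t)) has_real_derivative d i s) (at s)) \<and>
        (\<forall>i. (d i has_real_derivative e i) (at 0)) \<and>
        a \<le> (\<Sum>i\<in>UNIV. e i) + L * v (x, t)"
      by (intro exI[of _ ?a] exI[of _ ?d] exI[of _ ?e] conjI allI)
  qed
  then show ?thesis by (simp add: v_def W_def right_diff_distrib)
qed

section \<open>Speed bounds for the invasion\<close>

lemma smoothed_norm_gradient_near_1: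
  assumes "0 < \<rho>" "0 < \<eta>" "\<rho> / sqrt \<eta> \<le> N" "1 - A = \<rho>\<^sup>2 / N\<^sup>2"
  shows "1 - \<eta> \<le> A"
proof -
  have "0 < \<rho> / sqrt \<eta>" using assms(1,2) by simp
  then have "0 < N" using assms(3) by linarith
  have "(\<rho> / sqrt \<eta>)\<^sup>2 \<le> N\<^sup>2" using assms(3) \<open>0 < \<rho> / sqrt \<eta>\<close> by (intro power_mono) auto
  then have "\<rho>\<^sup>2 \<le> \<eta> * N\<^sup>2" using assms(2) by (simp add: power_divide field_simps)
  then have "\<rho>\<^sup>2 / N\<^sup>2 \<le> \<eta>" using \<open>0 < N\<close> by (simp add: divide_le_eq)
  then show ?thesis using assms(4) by linarith
qed

text \<open>
  If \<open>u\<close> is small on a large ball, it stays small at the centre until a front of speed \<open>\<nu> > \<kappa>\<close> that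
  starts from the boundary sphere has almost arrived. The barrier is the contracting spherical front
  of speed \<open>\<nu>\<close>: it lies above \<open>1\<close> on the boundary of the ball, and no information on \<open>u\<close> outside the
  ball enters. The constant \<open>C\<close> does not depend on the ball, which is what makes the lemma usable
  under rescaling.
\<close>

lemma invasion_not_faster_than_front:
  fixes u :: "(real^'n::finite) \<times> real \<Rightarrow> real"
  assumes struct: "reaction_structure f L \<alpha> \<beta> K m" and front: "monotone_front f \<kappa> g g'"
    and \<kappa>: "0 < \<kappa>" "\<kappa> < \<nu>" and u: "entire_solution f u"
  obtains \<sigma>0 where "0 < \<sigma>0"
    "\<And>\<sigma>. 0 < \<sigma> \<Longrightarrow> \<sigma> \<le> \<sigma>0 \<Longrightarrow> \<exists>C. \<forall>y R T0 T. (\<forall>x\<in>cball y R. u (x, T0) \<le> \<sigma>) \<and>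
       T0 \<le> T \<and> \<nu> * (T - T0) \<le> R - C \<longrightarrow> u (y, T) \<le> 2 * \<sigma>"
proof -
  note D = monotone_frontD[OF front]
  have range: "\<And>p. 0 < u p" "\<And>p. u p < 1" using u by (auto simp: entire_solution_def)
  obtain \<sigma>0 where \<sigma>0: "0 < \<sigma>0" and
    super: "\<And>\<sigma>. 0 < \<sigma> \<Longrightarrow> \<sigma> \<le> \<sigma>0 \<Longrightarrow> \<exists>\<eta> Z. 0 < \<eta> \<and>
       (\<forall>z A N. 0 \<le> A \<and> A \<le> 1 \<and> (1 - \<eta> \<le> A \<or> z \<le> Z) \<and> 0 \<le> N \<and> N \<le> \<eta> \<and> g z + \<sigma> < 1 \<longrightarrow>
          f (g z + \<sigma>) \<le> (\<nu> - N - A * \<kappa>) * g' z + A * f (g z))"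
    using supersolution_inequality[OF struct front \<kappa>] by blast
  have "\<exists>C. \<forall>y R T0 T. (\<forall>x\<in>cball y R. u (x, T0) \<le> \<sigma>) \<and>
       T0 \<le> T \<and> \<nu> * (T - T0) \<le> R - C \<longrightarrow> u (y, T) \<le> 2 * \<sigma>" if \<sigma>: "0 < \<sigma>" "\<sigma> \<le> \<sigma>0" for \<sigma>
  proof -
    obtain \<eta> Z where \<eta>: "0 < \<eta>" and
      ineq: "\<And>z A N. 0 \<le> A \<Longrightarrow> A \<le> 1 \<Longrightarrow> 1 - \<eta> \<le> A \<or> z \<le> Z \<Longrightarrow> 0 \<le> N \<Longrightarrow> N \<le> \<eta> \<Longrightarrow> g z + \<sigma> < 1 \<Longrightarrow>
          f (g z + \<sigma>) \<le> (\<nu> - N - A * \<kappa>) * g' z + A * f (g z)"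
      using super[OF \<sigma>] by blast
    \<comment> \<open>With this radius of smoothing the Laplacian of the smoothed norm is at most \<open>\<eta>\<close>.\<close>
    define \<rho> where "\<rho> = CARD('n) / \<eta>"
    have \<rho>: "0 < \<rho>" "real CARD('n) \<le> \<eta> * \<rho>" using \<eta> by (simp_all add: \<rho>_def)
    have "\<forall>\<^sub>F z in at_top. 1 - \<sigma> < g z" using D(7) \<sigma>(1) by (intro order_tendstoD) auto
    then obtain Z1 where Z1: "\<And>z. Z1 \<le> z \<Longrightarrow> 1 - \<sigma> < g z" by (auto simp: eventually_at_top_linorder)
    have "\<forall>\<^sub>F z in at_bot. g z < \<sigma>" using D(6) \<sigma>(1) by (intro order_tendstoD) auto
    then obtain Z2 where Z2: "\<And>z. z \<le> Z2 \<Longrightarrow> g z < \<sigma>" by (auto simp: eventually_at_bot_linorder)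
    \<comment> \<open>The second entry keeps the front away from the smoothed centre, where the gradient is not close
      to \<open>1\<close>; the third one makes the barrier at most \<open>2 \<sigma>\<close> in the centre.\<close>
    define C where "C = Max {0, Z1 + \<rho> / sqrt \<eta> - Z, Z1 + \<rho> - Z2}"
    have C: "0 \<le> C" "Z1 + \<rho> / sqrt \<eta> - Z \<le> C" "Z1 + \<rho> - Z2 \<le> C" by (simp_all add: C_def)
    have "u (y, T) \<le> 2 * \<sigma>"
      if small: "\<forall>x\<in>cball y R. u (x, T0) \<le> \<sigma>" and T: "T0 \<le> T" and time: "\<nu> * (T - T0) \<le> R - C"
      for y R T0 T
    proof -
      \<comment> \<open>At time \<open>T0\<close> the phase of the barrier is at least \<open>Z1\<close> on the sphere of radius \<open>R\<close>, so the
        barrier exceeds \<open>1\<close> there, also at all later times.\<close>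
      define c where "c = T0 - (Z1 - R) / \<nu>"
      have \<nu>: "0 < \<nu>" using \<kappa> by simp
      have phase: "\<nu> * (t - c) = \<nu> * (t - T0) + (Z1 - R)" for t
        using \<nu> by (simp add: c_def field_simps)
      note N = smoothed_norm_bounds[OF \<rho>(1)]
      have "0 \<le> \<nu> * (T - T0)" using \<nu> T by simp
      then have "0 \<le> R" using time C(1) by linarith
      have "1 * u (y, T) \<le> 1 * spherical_barrier g 1 \<sigma> \<nu> c \<rho> y (y, T)"
      proof (rule spherical_barrier_comparison[OF struct front u _ \<sigma>(1) \<rho>])
        fix x assume "x \<in> cball y R"
        then show "1 * u (x, T0) \<le> 1 * spherical_barrier g 1 \<sigma> \<nu> c \<rho> y (x, T0)"
          using small D(1) by (simp add: spherical_barrier_def add_increasing)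
      next
        fix x t assume x: "dist y x = R" and t: "T0 \<le> t" "t \<le> T"
        have "0 \<le> \<nu> * (t - T0)" using \<nu> t by simp
        moreover have "R \<le> smoothed_norm \<rho> (x - y)" using N(3)[of "x - y"] x by (simp add: dist_norm norm_minus_commute)
        ultimately have "Z1 \<le> \<nu> * (t - c) + smoothed_norm \<rho> (x - y)" unfolding phase by linarith
        from Z1[OF this] show "1 * u (x, t) \<le> 1 * spherical_barrier g 1 \<sigma> \<nu> c \<rho> y (x, t)"
          using range(2)[of "(x, t)"] by (simp add: spherical_barrier_def)
      next
        fix x t z A M
        assume t: "T0 \<le> t" "t \<le> T" and z: "z = \<nu> * (t - c) + 1 * smoothed_norm \<rho> (x - y)"
          and A: "0 \<le> A" "A \<le> 1" "1 - A = \<rho>\<^sup>2 / (smoothed_norm \<rho> (x - y))\<^sup>2"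
          and M: "0 \<le> M" "M \<le> \<eta>" and lt: "g z + 1 * \<sigma> < 1"
        have "1 - \<eta> \<le> A \<or> z \<le> Z"
        proof (cases "\<rho> / sqrt \<eta> \<le> smoothed_norm \<rho> (x - y)")
          case True
          then show ?thesis using smoothed_norm_gradient_near_1[OF \<rho>(1) \<eta> _ A(3)] by blast
        next
          case False
          have "\<nu> * (t - T0) \<le> \<nu> * (T - T0)" using \<nu> t by simp
          then have "z \<le> Z" using False C(2) time unfolding z phase by linarith
          then show ?thesis ..
        qed
        with ineq[OF A(1,2) this M] lt
        show "1 * f (g z + 1 * \<sigma>) \<le> 1 * ((\<nu> - 1 * M - A * \<kappa>) * g' z + A * f (g z))" by simp
      qed (use T \<open>0 \<le> R\<close> in auto)
      also have "\<dots> = g (\<nu> * (T - T0) + (Z1 - R) + smoothed_norm \<rho> (y - y)) + \<sigma>"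
        by (simp add: spherical_barrier_def phase)
      also have "\<dots> \<le> 2 * \<sigma>"
        using Z2[of "\<nu> * (T - T0) + (Z1 - R) + smoothed_norm \<rho> (y - y)"] N(4)[of "y - y"] C(3) time by simp
      finally show ?thesis by simp
    qed
    then show ?thesis by blast
  qed
  then show thesis using that \<sigma>0 by blast
qed

text \<open>
  If \<open>u\<close> is close to \<open>1\<close> on a large ball, the region where it is close to \<open>1\<close> expands at least with
  any speed \<open>\<nu> < \<kappa>\<close>. The barrier is an expanding spherical front; it is negative far out, so the
  lateral boundary of the comparison cylinder costs nothing.
\<close>

lemma invasion_not_slower_than_front:
  fixes u :: "(real^'n::finite) \<times> real \<Rightarrow> real"
  assumes struct: "reaction_structure f L \<alpha> \<beta> K m" and front: "monotone_front f \<kappa> g g'"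
    and \<nu>: "0 < \<nu>" "\<nu> < \<kappa>" and u: "entire_solution f u"
  obtains \<sigma>0 where "0 < \<sigma>0"
    "\<And>\<sigma>. 0 < \<sigma> \<Longrightarrow> \<sigma> \<le> \<sigma>0 \<Longrightarrow> \<exists>C. \<forall>y R T0 x T. C \<le> R \<and> (\<forall>x\<in>cball y R. 1 - \<sigma> \<le> u (x, T0)) \<and>
       T0 \<le> T \<and> dist y x \<le> \<nu> * (T - T0) + R - C \<longrightarrow> 1 - 2 * \<sigma> \<le> u (x, T)"
proof -
  note D = monotone_frontD[OF front]
  have range: "\<And>p. 0 < u p" "\<And>p. u p < 1" using u by (auto simp: entire_solution_def)
  obtain \<sigma>0 where \<sigma>0: "0 < \<sigma>0" and
    sub: "\<And>\<sigma>. 0 < \<sigma> \<Longrightarrow> \<sigma> \<le> \<sigma>0 \<Longrightarrow> \<exists>\<eta> Z. 0 < \<eta> \<and>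
       (\<forall>z A N. 0 \<le> A \<and> A \<le> 1 \<and> (1 - \<eta> \<le> A \<or> Z \<le> z) \<and> 0 \<le> N \<and> N \<le> \<eta> \<and> 0 < g z - \<sigma> \<longrightarrow>
          (\<nu> + N - A * \<kappa>) * g' z + A * f (g z) \<le> f (g z - \<sigma>))"
    using subsolution_inequality[OF struct front \<nu>] by blast
  have "\<exists>C. \<forall>y R T0 x T. C \<le> R \<and> (\<forall>x\<in>cball y R. 1 - \<sigma> \<le> u (x, T0)) \<and>
       T0 \<le> T \<and> dist y x \<le> \<nu> * (T - T0) + R - C \<longrightarrow> 1 - 2 * \<sigma> \<le> u (x, T)"
    if \<sigma>: "0 < \<sigma>" "\<sigma> \<le> \<sigma>0" for \<sigma>
  proof -
    obtain \<eta> Z where \<eta>: "0 < \<eta>" and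
      ineq: "\<And>z A N. 0 \<le> A \<Longrightarrow> A \<le> 1 \<Longrightarrow> 1 - \<eta> \<le> A \<or> Z \<le> z \<Longrightarrow> 0 \<le> N \<Longrightarrow> N \<le> \<eta> \<Longrightarrow> 0 < g z - \<sigma> \<Longrightarrow>
          (\<nu> + N - A * \<kappa>) * g' z + A * f (g z) \<le> f (g z - \<sigma>)"
      using sub[OF \<sigma>] by blast
    \<comment> \<open>With this radius of smoothing the Laplacian of the smoothed norm is at most \<open>\<eta>\<close>.\<close>
    define \<rho> where "\<rho> = CARD('n) / \<eta>"
    have \<rho>: "0 < \<rho>" "real CARD('n) \<le> \<eta> * \<rho>" using \<eta> by (simp_all add: \<rho>_def)
    have "\<forall>\<^sub>F z in at_bot. g z < \<sigma>" using D(6) \<sigma>(1) by (intro order_tendstoD) auto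
    then obtain Z1 where Z1: "\<And>z. z \<le> Z1 \<Longrightarrow> g z < \<sigma>" by (auto simp: eventually_at_bot_linorder)
    have "\<forall>\<^sub>F z in at_top. 1 - \<sigma> < g z" using D(7) \<sigma>(1) by (intro order_tendstoD) auto
    then obtain Z2 where Z2: "\<And>z. Z2 \<le> z \<Longrightarrow> 1 - \<sigma> < g z" by (auto simp: eventually_at_top_linorder)
    \<comment> \<open>The second entry ensures that the smoothed centre always lies well behind the front; the third
      one is the loss in the radius of the ball on which the barrier is at least \<open>1 - 2 \<sigma>\<close>.\<close>
    define C where "C = Max {0, Z + \<rho> / sqrt \<eta> - Z1, Z2 + \<rho> - Z1}"
    have C: "0 \<le> C" "Z + \<rho> / sqrt \<eta> - Z1 \<le> C" "Z2 + \<rho> - Z1 \<le> C" by (simp_all add: C_def)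
    have "1 - 2 * \<sigma> \<le> u (x, T)"
      if R: "C \<le> R" and large: "\<forall>x\<in>cball y R. 1 - \<sigma> \<le> u (x, T0)" and T: "T0 \<le> T"
        and x: "dist y x \<le> \<nu> * (T - T0) + R - C"
      for y R T0 x T
    proof -
      \<comment> \<open>At time \<open>T0\<close> the barrier is already negative on and outside the sphere of radius \<open>R\<close>.\<close>
      define c where "c = T0 - (Z1 + R) / \<nu>"
      have phase: "\<nu> * (t - c) = \<nu> * (t - T0) + (Z1 + R)" for t
        using \<nu> by (simp add: c_def field_simps)
      note N = smoothed_norm_bounds[OF \<rho>(1)]
      have below: "g (\<nu> * (t - c) - smoothed_norm \<rho> (x - y)) - \<sigma> < u (x, t)"
        if "\<nu> * (t - T0) + R \<le> dist y x" for x t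
      proof -
        have "\<nu> * (t - c) - smoothed_norm \<rho> (x - y) \<le> Z1"
          using that N(3)[of "x - y"] unfolding phase by (simp add: dist_norm norm_minus_commute)
        from Z1[OF this] show ?thesis using range(1)[of "(x, t)"] by linarith
      qed
      define R' where "R' = R + \<nu> * (T - T0)"
      have "-1 * u (x, T) \<le> -1 * spherical_barrier g (-1) \<sigma> \<nu> c \<rho> y (x, T)"
      proof (rule spherical_barrier_comparison[OF struct front u _ \<sigma>(1) \<rho>, of _ _ R'])
        fix x assume "x \<in> cball y R'"
        show "-1 * u (x, T0) \<le> -1 * spherical_barrier g (-1) \<sigma> \<nu> c \<rho> y (x, T0)"
        proof (cases "x \<in> cball y R")
          case True
          then have "1 - \<sigma> \<le> u (x, T0)" using large by blast
          then show ?thesis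
            using D(2)[of "\<nu> * (T0 - c) - smoothed_norm \<rho> (x - y)"] by (simp add: spherical_barrier_def)
        next
          case False
          then show ?thesis using below[of T0 x] by (simp add: spherical_barrier_def)
        qed
      next
        fix x t assume x: "dist y x = R'" and t: "T0 \<le> t" "t \<le> T"
        have "\<nu> * (t - T0) \<le> \<nu> * (T - T0)" using \<nu> t by simp
        then show "-1 * u (x, t) \<le> -1 * spherical_barrier g (-1) \<sigma> \<nu> c \<rho> y (x, t)"
          using below[of t x] x by (simp add: spherical_barrier_def R'_def)
      next
        fix x t z A M
        assume t: "T0 \<le> t" "t \<le> T" and z: "z = \<nu> * (t - c) + -1 * smoothed_norm \<rho> (x - y)"
          and A: "0 \<le> A" "A \<le> 1" "1 - A = \<rho>\<^sup>2 / (smoothed_norm \<rho> (x - y))\<^sup>2"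
          and M: "0 \<le> M" "M \<le> \<eta>" and lt: "0 < g z + -1 * \<sigma>"
        have "1 - \<eta> \<le> A \<or> Z \<le> z"
        proof (cases "\<rho> / sqrt \<eta> \<le> smoothed_norm \<rho> (x - y)")
          case True
          then show ?thesis using smoothed_norm_gradient_near_1[OF \<rho>(1) \<eta> _ A(3)] by blast
        next
          case False
          have "0 \<le> \<nu> * (t - T0)" using \<nu> t by simp
          then have "Z \<le> z" using False C(2) R unfolding z phase by linarith
          then show ?thesis ..
        qed
        with ineq[OF A(1,2) this M] lt
        show "-1 * f (g z + -1 * \<sigma>) \<le> -1 * ((\<nu> - -1 * M - A * \<kappa>) * g' z + A * f (g z))" by simp
      qed (use T C(1) x in \<open>auto simp: R'_def\<close>)
      then have "g (\<nu> * (T - T0) + (Z1 + R) - smoothed_norm \<rho> (x - y)) - \<sigma> \<le> u (x, T)"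
        by (simp add: spherical_barrier_def phase)
      moreover have "Z2 \<le> \<nu> * (T - T0) + (Z1 + R) - smoothed_norm \<rho> (x - y)"
        using N(4)[of "x - y"] C(3) x by (simp add: dist_norm norm_minus_commute)
      ultimately show ?thesis using Z2 by (smt (verit))
    qed
    then show ?thesis by blast
  qed
  then show thesis using that \<sigma>0 by blast
qed

section \<open>The width of the transition layer\<close>

text \<open>
  Each side of the graph is connected, so \<open>u - \<mu>\<close> has a constant sign on it. The lower side cannot
  be the one with \<open>u > \<mu>\<close>, since \<open>u\<close> increases in time there and would exceed \<open>\<mu>\<close> on the graph; and
  some point with \<open>u > \<mu>\<close> exists because the supremum of \<open>u\<close> is \<open>1\<close>.
\<close>

lemma level_graph_separates:
  fixes u :: "(real^'n::finite) \<times> real \<Rightarrow> real"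
  assumes u: "entire_solution f u" and H1: "H1 u" and \<mu>: "\<mu> < 1"
    and graph: "lipschitz_level_graph u \<mu> H"
    and inc: "\<And>p. \<mu> < u p \<Longrightarrow> 0 \<le> partial_t u p"
  shows "H x < t \<Longrightarrow> \<mu> < u (x, t)" and "t < H x \<Longrightarrow> u (x, t) < \<mu>"
proof -
  have C21: "C21 u" using u by (simp add: entire_solution_def)
  then have contu: "continuous_on UNIV u" by (simp add: C21_def)
  have level: "u (x, t) = \<mu> \<longleftrightarrow> t = H x" for x t
    using graph by (auto simp: lipschitz_level_graph_def set_eq_iff)
  have contH: "continuous_on UNIV H"
    using graph by (auto simp: lipschitz_level_graph_def intro: lipschitz_on_continuous_on)
  \<comment> \<open>Shearing by the graph turns the two sides into products of the whole space with a half-line.\<close>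
  have side: "(\<forall>p. snd p \<in> S \<longrightarrow> \<mu> < u (fst p, H (fst p) + snd p)) \<or>
      (\<forall>p. snd p \<in> S \<longrightarrow> u (fst p, H (fst p) + snd p) < \<mu>)"
    if "connected S" "0 \<notin> S" for S :: "real set"
  proof -
    let ?w = "\<lambda>p. u (fst p, H (fst p) + snd p)"
    have "connected ((UNIV :: (real^'n) set) \<times> S)" by (intro connected_Times[OF convex_connected[OF convex_UNIV]] that(1))
    moreover have "continuous_on (UNIV \<times> S) ?w"
      by (intro continuous_on_compose2[OF contu] continuous_intros continuous_on_compose2[OF contH]) auto
    ultimately have "connected (?w ` (UNIV \<times> S))" by (rule connected_continuous_image[rotated])
    then have interval: "{a..c} \<subseteq> ?w ` (UNIV \<times> S)"
      if "a \<in> ?w ` (UNIV \<times> S)" "c \<in> ?w ` (UNIV \<times> S)" for a c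
      using that by (rule connected_contains_Icc)
    have off: "?w p \<noteq> \<mu>" if "snd p \<in> S" for p
      using level[of "fst p" "H (fst p) + snd p"] \<open>0 \<notin> S\<close> that by auto
    show ?thesis
    proof (rule ccontr)
      assume "\<not> ?thesis"
      then obtain p q where pq: "snd p \<in> S" "?w p \<le> \<mu>" "snd q \<in> S" "\<mu> \<le> ?w q"
        by (auto simp: not_less)
      then have "?w p \<in> ?w ` (UNIV \<times> S)" "?w q \<in> ?w ` (UNIV \<times> S)"
        by (auto simp: mem_Times_iff)
      from subsetD[OF interval[OF this], of \<mu>] pq obtain p' where "snd p' \<in> S" "?w p' = \<mu>"
        by auto
      with off show False by blast
    qed
  qed
  have not_below: "\<exists>p. snd p \<in> {..<0} \<and> \<not> \<mu> < u (fst p, H (fst p) + snd p)"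
  proof (rule ccontr)
    assume "\<not> ?thesis"
    then have above: "\<mu> < u (x, t)" if "t < H x" for x t using that 
      by (metis add.commute diff_add_cancel diff_less_0_iff_less fst_conv lessThan_iff snd_conv)
    define x :: "real^'n" where "x = 0"
    have "u (x, H x - 1) \<le> u (x, H x)"
    proof (rule DERIV_nonneg_imp_increasing_open[where f = "\<lambda>t. u (x, t)"])
      show "\<exists>D. ((\<lambda>t. u (x, t)) has_real_derivative D) (at t) \<and> 0 \<le> D" if "t < H x" for t
        using has_real_derivative_partial_t[OF C21, of x t] inc[OF above[OF that]] by blast
      show "continuous_on {H x - 1..H x} (\<lambda>t. u (x, t))"
        by (intro continuous_on_compose2[OF contu] continuous_intros) auto
    qed simp
    moreover have "\<mu> < u (x, H x - 1)" using above by simp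
    ultimately show False using level[of x "H x"] by simp
  qed
  have below: "snd p \<in> {..<0} \<Longrightarrow> u (fst p, H (fst p) + snd p) < \<mu>" for p
    using side[of "{..<0}"] not_below by auto
  then show lt: "u (x, t) < \<mu>" if "t < H x" for x t
    using that below[of "(x, t - H x)"] by simp
  have "bdd_above (range (\<lambda>x. u (x, 0)))"
    using u by (intro bdd_aboveI[of _ 1]) (auto simp: entire_solution_def less_imp_le)
  then obtain x0 where "\<mu> < u (x0, 0)"
    using H1 \<mu> less_cSUP_iff[of UNIV "\<lambda>x. u (x, 0)" \<mu>] by (auto simp: H1_def)
  then have "0 < - H x0" using lt[of 0 x0] level[of x0 0] by (smt (verit))
  have "snd p \<in> {0<..} \<Longrightarrow> \<mu> < u (fst p, H (fst p) + snd p)" for p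
  proof -
    have "\<not> (\<forall>p. snd p \<in> {0<..} \<longrightarrow> u (fst p, H (fst p) + snd p) < \<mu>)"
    proof
      assume "\<forall>p. snd p \<in> {0<..} \<longrightarrow> u (fst p, H (fst p) + snd p) < \<mu>"
      from this[rule_format, of "(x0, - H x0)"] show False
        using \<open>0 < - H x0\<close> \<open>\<mu> < u (x0, 0)\<close> by simp
    qed
    moreover have "(\<forall>p. snd p \<in> {0<..} \<longrightarrow> \<mu> < u (fst p, H (fst p) + snd p)) \<or>
        (\<forall>p. snd p \<in> {0<..} \<longrightarrow> u (fst p, H (fst p) + snd p) < \<mu>)"
      by (rule side) simp_all
    ultimately show "snd p \<in> {0<..} \<Longrightarrow> \<mu> < u (fst p, H (fst p) + snd p)" by blast
  qed
  from this[of "(x, t - H x)"] show "\<mu> < u (x, t)" if "H x < t" using that by simp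
qed

text \<open>
  The graph \<open>H\<close> of the level \<open>1 - b\<^sub>0\<close> serves as reference. Above it, \<open>\<partial>\<^sub>t u \<ge> c\<^sub>0 (1 - u)\<close> makes \<open>1 - u\<close>
  decay exponentially in time. Below it, the distance to \<open>{u \<ge> 1 - b\<^sub>0}\<close> is comparable with \<open>H x - t\<close>
  because \<open>H\<close> is Lipschitz, and \<open>u\<close> is small where this distance is large. Consequently any other
  level graph \<open>h\<close> is within bounded distance of \<open>H\<close>, and the same bounds hold relative to \<open>h\<close>.
\<close>

lemma transition_layer_width:
  fixes u :: "(real^'n::finite) \<times> real \<Rightarrow> real"
  assumes u: "entire_solution f u" and H1: "H1 u" and H2: "H2 b0 u" and b0: "is_b0 TYPE('n) f b0"
    and b: "0 < b" "b < 1" and graph: "lipschitz_level_graph u b h" and \<sigma>: "0 < \<sigma>"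
  shows "\<exists>M. \<forall>x t. (h x + M \<le> t \<longrightarrow> 1 - \<sigma> \<le> u (x, t)) \<and> (t \<le> h x - M \<longrightarrow> u (x, t) \<le> \<sigma>)"
proof -
  have range: "\<And>p. 0 < u p" "\<And>p. u p < 1" and C21: "C21 u" using u by (auto simp: entire_solution_def)
  then have contu: "continuous_on UNIV u" by (simp add: C21_def)
  define \<mu> where "\<mu> = 1 - b0"
  have \<mu>: "0 < \<mu>" "\<mu> < 1" using b0 by (auto simp: is_b0_def \<mu>_def)
  obtain c0 H where c0: "0 < c0" and H: "lipschitz_level_graph u \<mu> H" and
    growth: "\<And>p. \<mu> < u p \<Longrightarrow> c0 * (1 - u p) \<le> partial_t u p"
    using b0 u H1 \<mu> unfolding is_b0_def \<mu>_def by (metis order.refl)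
  have "0 \<le> partial_t u p" if "\<mu> < u p" for p
    using growth[OF that] range(2)[of p] c0 by (smt (verit) mult_nonneg_nonneg)
  note sep = level_graph_separates[OF u H1 \<mu>(2) H this]
  have level: "u (x, H x) = \<mu>" for x using H by (auto simp: lipschitz_level_graph_def set_eq_iff)
  obtain L where "L-lipschitz_on UNIV H" using H by (auto simp: lipschitz_level_graph_def)
  then have L: "0 \<le> L" "\<bar>H x - H y\<bar> \<le> L * dist x y" for x y
    by (auto simp: lipschitz_on_def dist_real_def)

  have upper: "\<exists>M. \<forall>x t. H x + M \<le> t \<longrightarrow> 1 - \<delta> \<le> u (x, t)" if "0 < \<delta>" for \<delta>
  proof -
    define M where "M = max 0 (- ln \<delta> / c0)"
    have "1 - \<delta> \<le> u (x, t)" if t: "H x + M \<le> t" for x t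
    proof -
      let ?w = "\<lambda>\<tau>. (1 - u (x, \<tau>)) * exp (c0 * \<tau>)"
      have "?w t \<le> ?w (H x)"
      proof (rule DERIV_nonpos_imp_decreasing_open[where f = ?w])
        show "H x \<le> t" using t by (simp add: M_def)
        fix \<tau> assume "H x < \<tau>"
        then have "c0 * (1 - u (x, \<tau>)) \<le> partial_t u (x, \<tau>)" by (intro growth sep)
        then have "(c0 * (1 - u (x, \<tau>)) - partial_t u (x, \<tau>)) * exp (c0 * \<tau>) \<le> 0"
          by (simp add: mult_le_0_iff)
        moreover have "(?w has_real_derivative (c0 * (1 - u (x, \<tau>)) - partial_t u (x, \<tau>)) * exp (c0 * \<tau>)) (at \<tau>)"
          by (rule derivative_eq_intros has_real_derivative_partial_t[OF C21] refl)+
            (simp add: algebra_simps)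
        ultimately show "\<exists>D. (?w has_real_derivative D) (at \<tau>) \<and> D \<le> 0" by blast
      next
        show "continuous_on {H x..t} ?w"
          by (intro continuous_intros continuous_on_compose2[OF contu]) auto
      qed
      also have "\<dots> \<le> exp (c0 * H x)" using level[of x] \<mu> by simp
      also have "\<dots> \<le> \<delta> * exp (c0 * t)"
      proof -
        have "- ln \<delta> / c0 \<le> t - H x" using t by (simp add: M_def)
        then have "c0 * H x \<le> ln \<delta> + c0 * t" using c0 by (simp add: field_simps)
        then have "exp (c0 * H x) \<le> exp (ln \<delta> + c0 * t)" by simp
        then show ?thesis using \<open>0 < \<delta>\<close> by (simp add: exp_add)
      qed
      finally show ?thesis by simp
    qed
    then show ?thesis by blast
  qed

  have lower: "\<exists>M. \<forall>x t. t \<le> H x - M \<longrightarrow> u (x, t) \<le> \<delta>" if "0 < \<delta>" for \<delta>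
  proof -
    let ?S = "{q. u q \<ge> 1 - b0}"
    obtain R where R: "\<And>p. R \<le> infdist p ?S \<Longrightarrow> \<bar>u p\<bar> < \<delta>"
      using H2 \<open>0 < \<delta>\<close> unfolding H2_def by blast
    have "u (x, t) \<le> \<delta>" if t: "t \<le> H x - (1 + L) * R" for x t
    proof -
      have "R \<le> infdist (x, t) ?S"
      proof -
        have "(x, H x) \<in> ?S" using level[of x] by (simp add: \<mu>_def)
        moreover have "R \<le> dist (x, t) q" if "q \<in> ?S" for q
        proof -
          obtain y \<tau> where q: "q = (y, \<tau>)" by (cases q)
          have "H y \<le> \<tau>" using that sep(2)[of \<tau> y] q by (force simp: \<mu>_def)
          have "(1 + L) * R \<le> H x - t" using t by simp
          also have "\<dots> \<le> (\<tau> - t) + L * dist x y" using L(2)[of x y] \<open>H y \<le> \<tau>\<close> by linarith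
          also have "\<dots> \<le> dist (x, t) q + L * dist (x, t) q"
            using dist_snd_le[of "(x, t)" q] dist_fst_le[of "(x, t)" q] L(1)
            by (intro add_mono mult_left_mono) (auto simp: q dist_real_def)
          finally have "(1 + L) * R \<le> (1 + L) * dist (x, t) q" by (simp add: algebra_simps)
          then show ?thesis using L(1) by (simp add: mult_le_cancel_left)
        qed
        ultimately show ?thesis unfolding infdist_def by (auto intro!: cINF_greatest)
      qed
      from R[OF this] show ?thesis by simp
    qed
    then show ?thesis by blast
  qed

  obtain \<delta> where "0 < \<delta>" "\<delta> < min b (1 - b)" using dense[of 0 "min b (1 - b)"] b by auto
  then have \<delta>: "0 < \<delta>" "\<delta> < b" "b < 1 - \<delta>" by simp_all
  obtain M1 where M1: "\<And>x t. H x + M1 \<le> t \<Longrightarrow> 1 - \<delta> \<le> u (x, t)" using upper[OF \<delta>(1)] by blast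
  obtain M2 where M2: "\<And>x t. t \<le> H x - M2 \<Longrightarrow> u (x, t) \<le> \<delta>" using lower[OF \<delta>(1)] by blast
  obtain M3 where M3: "\<And>x t. H x + M3 \<le> t \<Longrightarrow> 1 - \<sigma> \<le> u (x, t)" using upper[OF \<sigma>] by blast
  obtain M4 where M4: "\<And>x t. t \<le> H x - M4 \<Longrightarrow> u (x, t) \<le> \<sigma>" using lower[OF \<sigma>] by blast
  have "u (x, h x) = b" for x using graph by (auto simp: lipschitz_level_graph_def set_eq_iff)
  then have near: "h x \<le> H x + M1" "H x - M2 \<le> h x" for x
    using M1[of x "h x"] M2[of "h x" x] \<delta> by (smt (verit))+
  show ?thesis
  proof (intro exI[of _ "max (M2 + M3) (M1 + M4)"] allI conjI impI)
    show "1 - \<sigma> \<le> u (x, t)" if "h x + max (M2 + M3) (M1 + M4) \<le> t" for x t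
      using that near[of x] by (intro M3) linarith
    show "u (x, t) \<le> \<sigma>" if "t \<le> h x - max (M2 + M3) (M1 + M4)" for x t
      using that near[of x] by (intro M4) linarith
  qed
qed

section \<open>The blow-down limit\<close>

lemma gderiv_first_order:
  assumes "GDERIV \<phi> x0 :> D" "0 < \<epsilon>"
  shows "\<forall>\<^sub>F x in nhds x0. \<bar>\<phi> x - \<phi> x0 - D \<bullet> (x - x0)\<bar> \<le> \<epsilon> * norm (x - x0)"
proof -
  have "(\<phi> has_derivative (\<lambda>h. h \<bullet> D)) (at x0)" using assms(1) by (simp add: gderiv_def)
  then obtain d where d: "0 < d" "\<And>y. norm (y - x0) < d \<Longrightarrow> norm (\<phi> y - \<phi> x0 - (y - x0) \<bullet> D) \<le> \<epsilon> * norm (y - x0)"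
    using assms(2) unfolding has_derivative_at_alt by blast
  then show ?thesis
    unfolding eventually_nhds_metric by (intro exI[of _ d]) (auto simp: dist_norm inner_commute)
qed

lemma rescaled_convergence:
  assumes lam: "\<And>i. 0 < lam i" "filterlim lam at_top sequentially"
    and conv: "\<And>K. compact K \<Longrightarrow> uniform_limit K (\<lambda>i. rescale (lam i) h) h_inf sequentially"
    and "compact K" "0 < \<epsilon>"
  shows "\<forall>\<^sub>F i in sequentially. \<Lambda> \<le> lam i \<and> (\<forall>x\<in>K. \<bar>h (lam i *\<^sub>R x) - lam i * h_inf x\<bar> \<le> lam i * \<epsilon>)"
proof -
  have "\<forall>\<^sub>F i in sequentially. \<Lambda> \<le> lam i" using lam(2) by (simp add: filterlim_at_top)
  moreover have "\<forall>\<^sub>F i in sequentially. \<forall>x\<in>K. dist (rescale (lam i) h x) (h_inf x) < \<epsilon>"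
    using conv[OF \<open>compact K\<close>] \<open>0 < \<epsilon>\<close> by (rule uniform_limitD)
  ultimately show ?thesis
  proof eventually_elim
    case (elim i)
    have "\<bar>h (lam i *\<^sub>R x) - lam i * h_inf x\<bar> \<le> lam i * \<epsilon>" if "x \<in> K" for x
    proof -
      have "h (lam i *\<^sub>R x) - lam i * h_inf x = lam i * (rescale (lam i) h x - h_inf x)"
        using lam(1)[of i] by (simp add: rescale_def algebra_simps)
      also have "\<bar>\<dots>\<bar> \<le> lam i * \<epsilon>"
        using elim(2) that lam(1)[of i] unfolding abs_mult by (auto simp: dist_real_def less_imp_le)
      finally show ?thesis .
    qed
    with elim(1) show ?case by blast
  qed
qed

theorem theorem1p5:
  fixes f :: "real \<Rightarrow> real"
    and \<kappa> b0 b :: real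
    and u :: "(real^'n::finite) \<times> real \<Rightarrow> real"
    and h h_inf :: "real^'n \<Rightarrow> real"
    and lam :: "nat \<Rightarrow> real"
  assumes "F1 f" "F2 f" "F3 f" "F4 f"
    and "is_front_speed f \<kappa>"
    and "is_b0 TYPE('n) f b0"
    and "entire_solution f u"
    and "H1 u" "H2 b0 u"
    and "0 < b" "b < 1"
    and "lipschitz_level_graph u b h"
    and "\<And>i. 0 < lam i"
    and "filterlim lam at_top sequentially"
    and "\<And>K. compact K \<Longrightarrow> uniform_limit K (\<lambda>i. rescale (lam i) h) h_inf sequentially"
  shows "eikonal_viscosity_solution \<kappa> h_inf"
proof -
  note u = \<open>entire_solution f u\<close>
  note layer = transition_layer_width[OF u \<open>H1 u\<close> \<open>H2 b0 u\<close> \<open>is_b0 TYPE('n) f b0\<close> \<open>0 < b\<close> \<open>b < 1\<close>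
    \<open>lipschitz_level_graph u b h\<close>]
  have rescaled: "\<forall>\<^sub>F i in sequentially. \<Lambda> \<le> lam i \<and>
      (\<forall>x\<in>K. \<bar>h (lam i *\<^sub>R x) - lam i * h_inf x\<bar> \<le> lam i * \<epsilon>)"
    if "compact K" "0 < \<epsilon>" for K \<epsilon> \<Lambda>
    by (rule rescaled_convergence[OF assms(13,14) _ that]) (rule assms(15))
  have on_graph: "u (x, h x) = b" for x
    using \<open>lipschitz_level_graph u b h\<close> by (auto simp: lipschitz_level_graph_def set_eq_iff)
  obtain L \<alpha> \<beta> K m where struct: "reaction_structure f L \<alpha> \<beta> K m"
    using reaction_structure_exists[OF \<open>F1 f\<close> \<open>F2 f\<close> \<open>F4 f\<close>] .
  have \<kappa>: "0 < \<kappa>" using \<open>is_front_speed f \<kappa>\<close> by (simp add: is_front_speed_def)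
  obtain g where "front_profile f \<kappa> g"
    using \<open>is_front_speed f \<kappa>\<close> by (auto simp: is_front_speed_def)
  moreover have "continuous_on {0..1} f"
    using \<open>F1 f\<close> by (auto simp: F1_def intro: lipschitz_on_continuous_on)
  ultimately obtain g' where front: "monotone_front f \<kappa> g g'"
    using front_profile_monotone[OF _ \<open>F3 f\<close> \<open>F4 f\<close> \<kappa>] by blast

  \<comment> \<open>If \<open>inverse \<kappa> < s < norm p\<close>, then at \<open>y\<close>, a step of length \<open>2 d\<close> down the gradient, the front arrives so
    early that an expanding ball with the admissible speed \<open>1 / s < \<kappa>\<close> starting at \<open>y\<close> reaches \<open>x0\<close>
    before the time \<open>h_inf x0\<close>.\<close>
  have upper: "norm p \<le> inverse \<kappa>"
    if "\<And>\<epsilon>. 0 < \<epsilon> \<Longrightarrow> \<forall>\<^sub>F x in nhds x0. h_inf x \<le> h_inf x0 + p \<bullet> (x - x0) + \<epsilon> * norm (x - x0)"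
    for p x0
  proof (rule ccontr)
    assume "\<not> norm p \<le> inverse \<kappa>"
    then have p: "inverse \<kappa> < norm p" by simp
    then obtain s where s: "inverse \<kappa> < s" "s < norm p" using dense by blast
    have s0: "0 < s" using s(1) \<kappa> by (meson inverse_positive_iff_positive less_trans)
    define \<nu> where "\<nu> = 1 / s"
    have \<nu>: "0 < \<nu>" "\<nu> < \<kappa>" using s s0 \<kappa> by (auto simp: \<nu>_def field_simps)
    obtain \<sigma>0 where \<sigma>0: "0 < \<sigma>0" and spread:
      "\<And>\<sigma>. 0 < \<sigma> \<Longrightarrow> \<sigma> \<le> \<sigma>0 \<Longrightarrow> \<exists>C. \<forall>y R T0 x T. C \<le> R \<and> (\<forall>x\<in>cball y R. 1 - \<sigma> \<le> u (x, T0)) \<and>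
         T0 \<le> T \<and> dist y x \<le> \<nu> * (T - T0) + R - C \<longrightarrow> 1 - 2 * \<sigma> \<le> u (x, T)"
      using invasion_not_slower_than_front[OF struct front \<nu> u] by blast
    define \<sigma> where "\<sigma> = min \<sigma>0 ((1 - b) / 4)"
    have "\<sigma> \<le> (1 - b) / 4" unfolding \<sigma>_def by (rule min.cobounded2)
    then have "b < 1 - 2 * \<sigma>" using \<open>b < 1\<close> by (simp add: field_simps)
    moreover have "0 < \<sigma>" "\<sigma> \<le> \<sigma>0" using \<sigma>0 \<open>b < 1\<close> by (simp_all add: \<sigma>_def)
    ultimately have \<sigma>: "0 < \<sigma>" "\<sigma> \<le> \<sigma>0" "b < 1 - 2 * \<sigma>" by blast+
    obtain C where C: "\<And>y R T0 x T. C \<le> R \<Longrightarrow> (\<And>x. x\<in>cball y R \<Longrightarrow> 1 - \<sigma> \<le> u (x, T0)) \<Longrightarrow>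
         T0 \<le> T \<Longrightarrow> dist y x \<le> \<nu> * (T - T0) + R - C \<Longrightarrow> 1 - 2 * \<sigma> \<le> u (x, T)"
      using spread[OF \<sigma>(1,2)] by blast
    obtain M where M: "\<And>x t. h x + M \<le> t \<Longrightarrow> 1 - \<sigma> \<le> u (x, t)"
        "\<And>x t. t \<le> h x - M \<Longrightarrow> u (x, t) \<le> \<sigma>"
      using layer[OF \<sigma>(1)] by blast
    \<comment> \<open>Twenty-four leaves room for all errors, each of which is a small multiple of \<open>\<epsilon> * d\<close>: the deviation
      of \<open>h_inf\<close> from the plane, that of the rescaled graphs from \<open>h_inf\<close>, and the constants \<open>M\<close> and \<open>C\<close>,
      which are negligible at large scale.\<close>
    define \<epsilon> where "\<epsilon> = (norm p - s) / 24"
    have "24 * \<epsilon> = norm p - s" by (simp add: \<epsilon>_def)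
    then have \<epsilon>: "0 < \<epsilon>" "norm p = s + 24 * \<epsilon>" using s by linarith+
    have "\<exists>r>0. \<forall>x. dist x x0 < r \<longrightarrow> h_inf x \<le> h_inf x0 + p \<bullet> (x - x0) + \<epsilon> * norm (x - x0)"
      using that[OF \<epsilon>(1)] by (simp only: eventually_nhds_metric)
    then obtain r where r: "0 < r" "\<forall>x. dist x x0 < r \<longrightarrow> h_inf x \<le> h_inf x0 + p \<bullet> (x - x0) + \<epsilon> * norm (x - x0)"
      by metis
    define d where "d = r / 4"
    have d: "0 < d" "3 * d < r" using r by (auto simp: d_def)
    define y where "y = x0 - (2 * d / norm p) *\<^sub>R p"
    have pn: "0 < norm p" using s s0 by linarith
    have yx0: "dist y x0 = 2 * d" using pn d by (simp add: y_def dist_norm)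
    have py: "p \<bullet> (y - x0) = - 2 * (norm p * d)"
      using pn by (simp add: y_def dot_square_norm power2_eq_square)
    define e where "e = \<epsilon> * d"
    have e: "0 < e" "norm p * d = s * d + 24 * e"
      using \<epsilon>(1) d(1) by (simp_all add: e_def \<epsilon>(2) distrib_right)
    define \<tau> where "\<tau> = h_inf x0 - norm p * d + 4 * e"
    have ball: "h_inf x \<le> \<tau> - e" if "x \<in> cball y d" for x
    proof -
      have x: "dist x x0 \<le> 3 * d" using that yx0 dist_triangle[of x x0 y] by (simp add: dist_commute)
      have "p \<bullet> (x - y) \<le> norm p * norm (x - y)" by (rule norm_cauchy_schwarz)
      also have "\<dots> \<le> norm p * d"
        using that by (intro mult_left_mono) (auto simp: dist_norm norm_minus_commute)
      finally have "p \<bullet> (x - x0) \<le> - (norm p * d)"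
        using py inner_diff_right[of p x y] inner_diff_right[of p y x0] inner_diff_right[of p x x0] by linarith
      moreover have "\<epsilon> * norm (x - x0) \<le> \<epsilon> * (3 * d)"
        using x \<epsilon>(1) by (intro mult_left_mono) (auto simp: dist_norm)
      then have "\<epsilon> * norm (x - x0) \<le> 3 * e" by (simp add: e_def)
      moreover have "dist x x0 < r" using x d(2) by linarith
      ultimately show ?thesis using r(2)[rule_format, of x] unfolding \<tau>_def by linarith
    qed
    define \<Lambda> where "\<Lambda> = Max {1, C / d, 2 * M / e, C * s / e}"
    have "\<forall>\<^sub>F i in sequentially. \<Lambda> \<le> lam i \<and> (\<forall>x\<in>insert x0 (cball y d).
        \<bar>h (lam i *\<^sub>R x) - lam i * h_inf x\<bar> \<le> lam i * (e / 2))"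
      using e(1) by (intro rescaled) auto
    from eventually_happens'[OF _ this] obtain i where i: "\<Lambda> \<le> lam i \<and>
        (\<forall>x\<in>insert x0 (cball y d). \<bar>h (lam i *\<^sub>R x) - lam i * h_inf x\<bar> \<le> lam i * (e / 2))"
      by (metis sequentially_bot)
    define \<xi> where "\<xi> = lam i"
    have close: "\<xi> * h_inf x - \<xi> * e / 2 \<le> h (\<xi> *\<^sub>R x)" "h (\<xi> *\<^sub>R x) \<le> \<xi> * h_inf x + \<xi> * e / 2"
      if "x \<in> insert x0 (cball y d)" for x
    proof -
      have "\<bar>h (\<xi> *\<^sub>R x) - \<xi> * h_inf x\<bar> \<le> \<xi> * e / 2"
        using bspec[OF conjunct2[OF i] that] by (simp add: \<xi>_def)
      then show "\<xi> * h_inf x - \<xi> * e / 2 \<le> h (\<xi> *\<^sub>R x)" "h (\<xi> *\<^sub>R x) \<le> \<xi> * h_inf x + \<xi> * e / 2"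
        by linarith+
    qed
    have "1 \<le> \<xi>" "C / d \<le> \<xi>" "2 * M / e \<le> \<xi>" "C * s / e \<le> \<xi>"
      using i by (simp_all add: \<Lambda>_def \<xi>_def)
    then have \<xi>: "0 < \<xi>" "C \<le> \<xi> * d" "2 * M \<le> \<xi> * e" "C * s \<le> \<xi> * e"
      using e(1) d(1) by (simp_all add: pos_divide_le_eq)
    have nonneg: "0 \<le> \<xi> * (s * d)" "0 < \<xi> * e" using \<xi>(1) s0 d(1) e(1) by simp_all
    have \<tau>: "\<xi> * \<tau> = \<xi> * h_inf x0 - \<xi> * (s * d) - 20 * (\<xi> * e)"
      unfolding \<tau>_def e(2) by (simp add: algebra_simps)
    define T where "T = h (\<xi> *\<^sub>R x0)"
    have gap: "\<xi> * (s * d) + \<xi> * e \<le> T - \<xi> * \<tau>"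
      using close(1)[of x0] \<tau> nonneg by (simp add: T_def)
    have "1 - 2 * \<sigma> \<le> u (\<xi> *\<^sub>R x0, T)"
    proof (rule C[of "\<xi> * d" "\<xi> *\<^sub>R y" "\<xi> * \<tau>"])
      show "C \<le> \<xi> * d" by (rule \<xi>)
      show "\<xi> * \<tau> \<le> T" using gap nonneg by linarith
      have "(\<xi> * d + C) * s = \<xi> * (s * d) + C * s" by (simp add: distrib_right)
      then have "(\<xi> * d + C) * s \<le> T - \<xi> * \<tau>" using gap \<xi>(4) by linarith
      then have "\<xi> * d + C \<le> \<nu> * (T - \<xi> * \<tau>)" using s0 by (simp add: \<nu>_def pos_le_divide_eq)
      moreover have "dist (\<xi> *\<^sub>R y) (\<xi> *\<^sub>R x0) = \<xi> * (2 * d)"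
        using \<xi>(1) yx0 by (simp add: dist_norm flip: scaleR_diff_right)
      ultimately show "dist (\<xi> *\<^sub>R y) (\<xi> *\<^sub>R x0) \<le> \<nu> * (T - \<xi> * \<tau>) + \<xi> * d - C" by simp
      fix x assume x: "x \<in> cball (\<xi> *\<^sub>R y) (\<xi> * d)"
      define x' where "x' = (1 / \<xi>) *\<^sub>R x"
      have xx': "x = \<xi> *\<^sub>R x'" using \<xi>(1) by (simp add: x'_def)
      have x': "x' \<in> cball y d" using x \<xi>(1) by (simp add: xx' dist_norm flip: scaleR_diff_right)
      have "h x \<le> \<xi> * h_inf x' + \<xi> * e / 2" using close(2)[of x'] x' by (simp add: xx')
      moreover have "\<xi> * h_inf x' \<le> \<xi> * (\<tau> - e)"
        using ball[OF x'] \<xi>(1) by (intro mult_left_mono) auto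
      then have "\<xi> * h_inf x' \<le> \<xi> * \<tau> - \<xi> * e" by (simp add: right_diff_distrib)
      ultimately have "h x + M \<le> \<xi> * \<tau>" using \<xi>(3) by linarith
      then show "1 - \<sigma> \<le> u (x, \<xi> * \<tau>)" by (rule M(1))
    qed
    then show False using on_graph[of "\<xi> *\<^sub>R x0"] \<sigma>(3) by (simp add: T_def)
  qed

  \<comment> \<open>If \<open>norm p < s < inverse \<kappa>\<close>, then at the time \<open>\<tau>\<close> nothing has arrived in the ball of radius \<open>d\<close>
    around \<open>x0\<close>. Fronts invade that ball with speed at most \<open>1 / s > \<kappa>\<close>, so they need the time \<open>s d\<close> to
    reach \<open>x0\<close>, which is later than \<open>h_inf x0\<close>.\<close>
  have lower: "inverse \<kappa> \<le> norm p"
    if "\<And>\<epsilon>. 0 < \<epsilon> \<Longrightarrow> \<forall>\<^sub>F x in nhds x0. h_inf x0 + p \<bullet> (x - x0) - \<epsilon> * norm (x - x0) \<le> h_inf x"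
    for p x0
  proof (rule ccontr)
    assume "\<not> inverse \<kappa> \<le> norm p"
    then obtain s where s: "norm p < s" "s < inverse \<kappa>" using dense by (meson not_le)
    have s0: "0 < s" using s(1) norm_ge_zero[of p] by linarith
    define \<nu> where "\<nu> = 1 / s"
    have "\<kappa> < \<nu>" using s s0 \<kappa> by (auto simp: \<nu>_def field_simps)
    obtain \<sigma>0 where \<sigma>0: "0 < \<sigma>0" and spread:
      "\<And>\<sigma>. 0 < \<sigma> \<Longrightarrow> \<sigma> \<le> \<sigma>0 \<Longrightarrow> \<exists>C. \<forall>y R T0 T. (\<forall>x\<in>cball y R. u (x, T0) \<le> \<sigma>) \<and>
         T0 \<le> T \<and> \<nu> * (T - T0) \<le> R - C \<longrightarrow> u (y, T) \<le> 2 * \<sigma>"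
      using invasion_not_faster_than_front[OF struct front \<kappa> \<open>\<kappa> < \<nu>\<close> u] by blast
    define \<sigma> where "\<sigma> = min \<sigma>0 (b / 4)"
    have \<sigma>: "0 < \<sigma>" "\<sigma> \<le> \<sigma>0" "2 * \<sigma> < b" using \<sigma>0 \<open>0 < b\<close> by (auto simp: \<sigma>_def min_def)
    obtain C where C: "\<And>y R T0 T. (\<And>x. x\<in>cball y R \<Longrightarrow> u (x, T0) \<le> \<sigma>) \<Longrightarrow>
         T0 \<le> T \<Longrightarrow> \<nu> * (T - T0) \<le> R - C \<Longrightarrow> u (y, T) \<le> 2 * \<sigma>"
      using spread[OF \<sigma>(1,2)] by blast
    obtain M where M: "\<And>x t. h x + M \<le> t \<Longrightarrow> 1 - \<sigma> \<le> u (x, t)"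
        "\<And>x t. t \<le> h x - M \<Longrightarrow> u (x, t) \<le> \<sigma>"
      using layer[OF \<sigma>(1)] by blast
    define \<epsilon> where "\<epsilon> = (s - norm p) / 4"
    have "4 * \<epsilon> = s - norm p" by (simp add: \<epsilon>_def)
    then have \<epsilon>: "0 < \<epsilon>" "s = norm p + 4 * \<epsilon>" using s by linarith+
    have "\<exists>r>0. \<forall>x. dist x x0 < r \<longrightarrow> h_inf x0 + p \<bullet> (x - x0) - \<epsilon> * norm (x - x0) \<le> h_inf x"
      using that[OF \<epsilon>(1)] by (simp only: eventually_nhds_metric)
    then obtain r where r: "0 < r" "\<forall>x. dist x x0 < r \<longrightarrow> h_inf x0 + p \<bullet> (x - x0) - \<epsilon> * norm (x - x0) \<le> h_inf x"
      by metis
    define d where "d = r / 2"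
    have d: "0 < d" "d < r" using r by (auto simp: d_def)
    define e where "e = \<epsilon> * d"
    have e: "0 < e" "s * d = norm p * d + 4 * e"
      using \<epsilon>(1) d(1) by (simp_all add: e_def \<epsilon>(2) distrib_right)
    define \<tau> where "\<tau> = h_inf x0 - norm p * d - 2 * e"
    have ball: "\<tau> + e \<le> h_inf x" if "x \<in> cball x0 d" for x
    proof -
      have x: "norm (x - x0) \<le> d" using that by (simp add: dist_norm norm_minus_commute)
      have "- (p \<bullet> (x - x0)) \<le> norm p * norm (x - x0)"
        using norm_cauchy_schwarz[of "- p" "x - x0"] by simp
      also have "\<dots> \<le> norm p * d" using x by (intro mult_left_mono) auto
      finally have "- (norm p * d) \<le> p \<bullet> (x - x0)" by simp
      moreover have "\<epsilon> * norm (x - x0) \<le> e"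
        unfolding e_def using x \<epsilon>(1) by (intro mult_left_mono) auto
      moreover have "dist x x0 < r" using x d(2) by (simp add: dist_norm)
      ultimately show ?thesis using r(2)[rule_format, of x] unfolding \<tau>_def by linarith
    qed
    define \<Lambda> where "\<Lambda> = Max {1, 2 * M / e, C * s / e}"
    have "\<forall>\<^sub>F i in sequentially. \<Lambda> \<le> lam i \<and> (\<forall>x\<in>cball x0 d.
        \<bar>h (lam i *\<^sub>R x) - lam i * h_inf x\<bar> \<le> lam i * (e / 2))"
      using e(1) by (intro rescaled) auto
    from eventually_happens'[OF _ this] obtain i where i: "\<Lambda> \<le> lam i \<and>
        (\<forall>x\<in>cball x0 d. \<bar>h (lam i *\<^sub>R x) - lam i * h_inf x\<bar> \<le> lam i * (e / 2))"
      by (metis sequentially_bot)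
    define \<xi> where "\<xi> = lam i"
    have close: "\<xi> * h_inf x - \<xi> * e / 2 \<le> h (\<xi> *\<^sub>R x)" "h (\<xi> *\<^sub>R x) \<le> \<xi> * h_inf x + \<xi> * e / 2"
      if "x \<in> cball x0 d" for x
    proof -
      have "\<bar>h (\<xi> *\<^sub>R x) - \<xi> * h_inf x\<bar> \<le> \<xi> * e / 2"
        using bspec[OF conjunct2[OF i] that] by (simp add: \<xi>_def)
      then show "\<xi> * h_inf x - \<xi> * e / 2 \<le> h (\<xi> *\<^sub>R x)" "h (\<xi> *\<^sub>R x) \<le> \<xi> * h_inf x + \<xi> * e / 2"
        by linarith+
    qed
    have "1 \<le> \<xi>" "2 * M / e \<le> \<xi>" "C * s / e \<le> \<xi>"
      using i by (simp_all add: \<Lambda>_def \<xi>_def)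
    then have \<xi>: "0 < \<xi>" "2 * M \<le> \<xi> * e" "C * s \<le> \<xi> * e"
      using e(1) by (simp_all add: pos_divide_le_eq)
    have nonneg: "0 \<le> \<xi> * (norm p * d)" "0 < \<xi> * e" using \<xi>(1) d(1) e(1) by simp_all
    have \<tau>: "\<xi> * \<tau> = \<xi> * h_inf x0 - \<xi> * (norm p * d) - 2 * (\<xi> * e)"
      unfolding \<tau>_def by (simp add: algebra_simps)
    have sd: "\<xi> * (s * d) = \<xi> * (norm p * d) + 4 * (\<xi> * e)"
      unfolding e(2) by (simp add: algebra_simps)
    define T where "T = h (\<xi> *\<^sub>R x0)"
    have T: "\<xi> * h_inf x0 - \<xi> * e / 2 \<le> T" "T \<le> \<xi> * h_inf x0 + \<xi> * e / 2"
      unfolding T_def using close[of x0] d(1) by simp_all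
    have "u (\<xi> *\<^sub>R x0, T) \<le> 2 * \<sigma>"
    proof (rule C[of "\<xi> *\<^sub>R x0" "\<xi> * d" "\<xi> * \<tau>"])
      show "\<xi> * \<tau> \<le> T" using T(1) \<tau> nonneg by linarith
      have "T - \<xi> * \<tau> \<le> \<xi> * (s * d) - C * s" using T(2) \<tau> sd \<xi>(3) nonneg by linarith
      also have "\<dots> = (\<xi> * d - C) * s" by (simp add: left_diff_distrib)
      finally show "\<nu> * (T - \<xi> * \<tau>) \<le> \<xi> * d - C"
        using s0 by (simp add: \<nu>_def pos_divide_le_eq)
      fix x assume x: "x \<in> cball (\<xi> *\<^sub>R x0) (\<xi> * d)"
      define x' where "x' = (1 / \<xi>) *\<^sub>R x"
      have xx': "x = \<xi> *\<^sub>R x'" using \<xi>(1) by (simp add: x'_def)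
      have x': "x' \<in> cball x0 d" using x \<xi>(1) by (simp add: xx' dist_norm flip: scaleR_diff_right)
      have "\<xi> * h_inf x' - \<xi> * e / 2 \<le> h x" using close(1)[OF x'] by (simp add: xx')
      moreover have "\<xi> * (\<tau> + e) \<le> \<xi> * h_inf x'"
        using ball[OF x'] \<xi>(1) by (intro mult_left_mono) auto
      then have "\<xi> * \<tau> + \<xi> * e \<le> \<xi> * h_inf x'" by (simp add: distrib_left)
      ultimately have "\<xi> * \<tau> \<le> h x - M" using \<xi>(2) by linarith
      then show "u (x, \<xi> * \<tau>) \<le> \<sigma>" by (rule M(2))
    qed
    then show False using on_graph[of "\<xi> *\<^sub>R x0"] \<sigma>(3) by (simp add: T_def)
  qed

  show ?thesis
    unfolding eikonal_viscosity_solution_def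
  proof (intro allI impI conjI)
    fix \<phi> :: "real^'n \<Rightarrow> real" and D :: "real^'n \<Rightarrow> real^'n" and x0 :: "real^'n"
    assume "(\<forall>x. GDERIV \<phi> x :> D x) \<and> continuous_on UNIV D"
    then have d: "GDERIV \<phi> x0 :> D x0" by blast
    show "norm (D x0) \<le> inverse \<kappa>" if max: "\<forall>\<^sub>F x in nhds x0. h_inf x - \<phi> x \<le> h_inf x0 - \<phi> x0"
    proof (rule upper)
      fix \<epsilon> :: real assume "0 < \<epsilon>"
      from max gderiv_first_order[OF d this]
      show "\<forall>\<^sub>F x in nhds x0. h_inf x \<le> h_inf x0 + D x0 \<bullet> (x - x0) + \<epsilon> * norm (x - x0)"
        by eventually_elim linarith
    qed
    show "inverse \<kappa> \<le> norm (D x0)" if min: "\<forall>\<^sub>F x in nhds x0. h_inf x - \<phi> x \<ge> h_inf x0 - \<phi> x0"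
    proof (rule lower)
      fix \<epsilon> :: real assume "0 < \<epsilon>"
      from min gderiv_first_order[OF d this]
      show "\<forall>\<^sub>F x in nhds x0. h_inf x0 + D x0 \<bullet> (x - x0) - \<epsilon> * norm (x - x0) \<le> h_inf x"
        by eventually_elim linarith
    qed
  qed
qed

end
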